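(* Let $n\ge 2$ and let $(X_0,X_1,X_2,\dots)$ be a reduced random walk on the alcoves of the affine arrangement of type $\tilde A_{n-1}$. Let $\psi=\psi_{\mathrm{id}}$ denote the unit vector giving the limiting direction of the reduced random walk constrained to the fundamental chamber; that is, conditioned on all $X_i$ lying in the fundamental Weyl chamber, $\lim_{i\to\infty} v(X_i)=\psi$ almost surely. Then $$\psi=\frac{1}{\sqrt{2\binom{n+1}{3}}}\sum_{k=1}^n (n+1-2k)\,e_k ,$$ where $e_k$ is the $k$-th standard unit vector of $\mathbb R^n$.
   Context: Work in $V=\{x\in\mathbb R^n: x_1+\dots+x_n=0\}$. The affine arrangement of type $\tilde A_{n-1}$ consists of the hyperplanes $\{x_i-x_j=d\}$, $1\le i<j\le n$, $d\in\mathbb Z$; the connected components of its complement in $V$ are the alcoves. The fundamental alcove is $\{x_n+1>x_1>x_2>\dots>x_n\}$ and the fundamental (Weyl) chamber is $\{x_1>x_2>\dots>x_n\}$. A reduced random walk is the random sequence of alcoves with $X_0$ the fundamental alcove in which, at each step, one chooses uniformly at random one of the walls (hyperplanes) of the current alcove that has not been crossed before and moves to the adjacent alcove across that wall; thus the walk never crosses the same hyperplane twice. For an alcove $X$, $v(X)$ is the unit vector pointing from the origin towards the central point of $X$. It is known (Lam) that there is a unit vector $\psi$ such that almost surely $\lim_{i\to\infty}v(X_i)$ exists and lies in the orbit $S_n\cdot\psi$, where the symmetric group $S_n$ (the finite Weyl group $A_{n-1}$) acts by permuting coordinates; the element of this orbit in the closed fundamental chamber is the limiting direction for the walk constrained to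 the fundamental chamber. *)

theory Defs
  imports "HOL-Probability.Probability"
begin

text \<open>Coordinates are indexed by a finite linearly ordered type \<open>'n\<close> with \<open>n = CARD('n)\<close>
  elements; the index \<open>k \<in> {1, ..., n}\<close> of a coordinate is its rank in that order.\<close>

definition coord_index :: "'n::{finite,linorder} \<Rightarrow> nat" where
  "coord_index k = card {..k}"

definition sum_zero_space :: "(real ^ 'n::{finite,linorder}) set" where
  "sum_zero_space = {x. (\<Sum>i\<in>UNIV. x $ i) = 0}"

definition hyperplanes :: "(real ^ 'n::{finite,linorder}) set set" where
  "hyperplanes = {{x \<in> sum_zero_space. x $ i - x $ j = of_int d} | i j d. i < j}"

definition alcoves :: "(real ^ 'n::{finite,linorder}) set set" where
  "alcoves = components (sum_zero_space - \<Union>hyperplanes)"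

definition fundamental_chamber :: "(real ^ 'n::{finite,linorder}) set" where
  "fundamental_chamber = {x \<in> sum_zero_space. \<forall>i j. i < j \<longrightarrow> x $ i > x $ j}"

definition fundamental_alcove :: "(real ^ 'n::{finite,linorder}) set" where
  "fundamental_alcove = {x \<in> sum_zero_space. x $ Max UNIV + 1 > x $ Min UNIV \<and> (\<forall>i j. i < j \<longrightarrow> x $ i > x $ j)}"

definition walls :: "(real ^ 'n::{finite,linorder}) set \<Rightarrow> (real ^ 'n::{finite,linorder}) set set" where
  "walls A = {H \<in> hyperplanes. (H \<inter> closure A) facet_of closure A}"

text \<open>\<open>B\<close> is the alcove adjacent to \<open>A\<close> across the wall \<open>H\<close>: the other alcove having the facet
  \<open>H \<inter> closure A\<close>.\<close>

definition adjacent_across ::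
  "(real ^ 'n::{finite,linorder}) set \<Rightarrow> (real ^ 'n::{finite,linorder}) set \<Rightarrow> (real ^ 'n::{finite,linorder}) set \<Rightarrow> bool" where
  "adjacent_across H A B \<longleftrightarrow>
     A \<in> alcoves \<and> B \<in> alcoves \<and> B \<noteq> A \<and> H \<in> walls A \<and> H \<in> walls B \<and>
     H \<inter> closure A = H \<inter> closure B"

text \<open>The walls of \<open>A i\<close> that the path \<open>A 0, ..., A i\<close> has not crossed.\<close>

definition uncrossed_walls ::
  "(nat \<Rightarrow> (real ^ 'n::{finite,linorder}) set) \<Rightarrow> nat \<Rightarrow> (real ^ 'n::{finite,linorder}) set set" where
  "uncrossed_walls A i = {H \<in> walls (A i). \<not> (\<exists>j<i. adjacent_across H (A j) (A (Suc j)))}"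

text \<open>Given a history \<open>X 0 = A 0, ..., X i = A i\<close> of positive probability, the next alcove
  is \<open>B\<close> with the probability that a uniformly chosen uncrossed wall of \<open>A i\<close> leads to \<open>B\<close>.\<close>

definition reduced_random_walk ::
  "'w measure \<Rightarrow> (nat \<Rightarrow> 'w \<Rightarrow> (real ^ 'n::{finite,linorder}) set) \<Rightarrow> bool" where
  "reduced_random_walk M X \<longleftrightarrow>
     prob_space M \<and>
     (\<forall>i. X i \<in> measurable M (count_space alcoves)) \<and>
     (AE \<omega> in M. X 0 \<omega> = fundamental_alcove) \<and>
     (\<forall>i A B. \<P>(\<omega> in M. \<forall>j\<le>i. X j \<omega> = A j) > 0 \<longrightarrow>
        \<P>(\<omega> in M. X (Suc i) \<omega> = B \<bar> \<forall>j\<le>i. X j \<omega> = A j) =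
        measure_pmf.prob (pmf_of_set (uncrossed_walls A i)) {H. adjacent_across H (A i) B})"

text \<open>An alcove is an open simplex; its central point is the barycenter of its vertices.\<close>

definition central_point :: "(real ^ 'n::{finite,linorder}) set \<Rightarrow> real ^ 'n::{finite,linorder}" where
  "central_point A =
     (let P = {p. p extreme_point_of closure A} in (1 / real (card P)) *\<^sub>R (\<Sum>p\<in>P. p))"

definition direction :: "(real ^ 'n::{finite,linorder}) set \<Rightarrow> real ^ 'n::{finite,linorder}" where
  "direction A = sgn (central_point A)"

end

theory Submission
  imports Defs
begin

text \<open>An alcove is encoded by the places \<open>p a\<close> of its coordinates in the ordered list of all reals
  \<open>x c + k\<close>, \<open>k\<close> an integer; its centre is \<open>p / n\<close> up to a constant. Crossing a wall exchanges the places of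
  two coordinates with consecutive places. Modulo \<open>n\<close>, the walk inside the fundamental chamber is
  therefore a multispecies TASEP on a ring of \<open>n\<close> sites, where smaller labels jump forward over larger
  ones. The labels \<open>\<le> k\<close> alone form a TASEP of \<open>k\<close> particles, for which the uniform measure is
  stationary and has current proportional to \<open>k (n - k)\<close>. Solving the Poisson equation for the current
  turns \<open>(\<Sum>a\<le>k. p a) / (k (n - k))\<close>, up to a bounded term, into a function whose increments over
  the moves inside the chamber have a sum independent of the alcove and of \<open>k\<close>. The difference of two
  such functions is \<open>o(t)\<close> in mean square while the walk stays in the chamber, so the partial sums of
  the limiting direction are proportional to \<open>k (n - k)\<close>.\<close>

section \<open>The Poisson equation for the TASEP on a ring\<close>

text \<open>The obstacle is time. A step of the walk is uniform over a set of moves whose size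
  varies with the alcove, so the labels \<open>\<le> k\<close> do not evolve by themselves in
  discrete time. The Poisson equation is therefore used for unweighted sums over moves: passing to
  the actual step divides the drifts for \<open>k\<close> and for \<open>l\<close> by the same
  unknown number of permitted moves, and a suitable difference of the two has drift zero whatever
  that number is. This yields only the ratios of the partial sums of the limit; sum zero, unit
  length and the sign of one coordinate fix the rest.

  The process conditioned on staying in the chamber is never constructed. All estimates concern the
  unconditioned probabilities of paths inside the chamber, a total mass that may shrink with time;
  what has probability zero there has conditional probability zero as well.

  A mean square bound suffices because convergence is assumed: a wrong limit would force a linearly
  large difference at all late times, while at each single time \<open>t\<close> this has
  probability \<open>O(1/t)\<close>.\<close>

lemma orthogonal_imp_in_range:
  fixes T :: "'a::euclidean_space \<Rightarrow> 'a"
  assumes "linear T" and "\<And>y. (\<And>x. T x \<bullet> y = 0) \<Longrightarrow> g \<bullet> y = 0"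
  shows "g \<in> range T"
proof -
  have sub: "subspace (range T)"
    using assms(1) by (simp add: linear_subspace_image)
  \<comment> \<open>Fredholm alternative: in finite dimension a subspace is its own double
    orthogonal complement.\<close>
  have "g \<in> (range T)\<^sup>\<bottom>\<^sup>\<bottom>"
    unfolding orthogonal_comp_def orthogonal_def
    using assms(2) by (auto simp: inner_commute)
  then show ?thesis
    using orthogonal_comp_self[OF sub] by simp
qed

definition hop :: "('s \<Rightarrow> 's) \<Rightarrow> 's \<Rightarrow> 's set \<Rightarrow> 's set" where
  "hop \<sigma> s \<eta> = insert (\<sigma> s) (\<eta> - {s})"

definition hop_sites :: "('s \<Rightarrow> 's) \<Rightarrow> 's set \<Rightarrow> 's set" where
  "hop_sites \<sigma> \<eta> = {s \<in> \<eta>. \<sigma> s \<notin> \<eta>}"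

text \<open>The expected number of possible hops in a uniformly random \<open>k\<close>-subset of
  \<open>n\<close> sites on a ring: each of the \<open>n\<close> sites is occupied with an empty
  successor with probability \<open>k (n - k) / (n (n - 1))\<close>.\<close>

definition mean_current :: "nat \<Rightarrow> nat \<Rightarrow> real" where
  "mean_current n k = real k * (real n - real k) / (real n - 1)"

text \<open>\<open>\<sigma>\<close> is a single cycle through all sites. The later instance is
  \<open>next_label origin_code\<close>, whose sites are labels; the abstract form keeps arithmetic
  modulo \<open>n\<close> out of this part.\<close>

locale ring_sites =
  fixes \<sigma> :: "'s::finite \<Rightarrow> 's"
  assumes bij_shift: "bij \<sigma>"
    and single_orbit: "\<And>s t. \<exists>i. (\<sigma> ^^ i) s = t"
    and card_ge_2: "CARD('s) \<ge> 2"
begin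

lemma shift_neq: "\<sigma> s \<noteq> s"
proof
  assume "\<sigma> s = s"
  then have "(\<sigma> ^^ i) s = s" for i by (induction i) auto
  then have "UNIV = {s}" using single_orbit[of s] by (metis UNIV_eq_I singletonI)
  then have "CARD('s) = card {s}" by metis
  then show False using card_ge_2 by simp
qed

text \<open>Around a cycle, blocks of particles have as many beginnings as ends: both counts are
  \<open>card \<eta>\<close> minus the number of particles followed by a particle, since the
  preimage of \<open>\<eta>\<close> under the bijection \<open>\<sigma>\<close> has the size of
  \<open>\<eta>\<close>.\<close>

lemma card_entry_sites: "card {s. s \<notin> \<eta> \<and> \<sigma> s \<in> \<eta>} = card (hop_sites \<sigma> \<eta>)"
proof -
  have c: "card {s. \<sigma> s \<in> \<eta>} = card \<eta>"
    using bij_shift by (metis vimage_def bij_def card_vimage_inj inj_def subset_UNIV)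
  have "card {s. \<sigma> s \<in> \<eta>} = card {s. s \<notin> \<eta> \<and> \<sigma> s \<in> \<eta>} + card {s. s \<in> \<eta> \<and> \<sigma> s \<in> \<eta>}"
    by (subst card_Un_disjoint[symmetric]) (auto intro: arg_cong[where f=card])
  moreover have "card \<eta> = card (hop_sites \<sigma> \<eta>) + card {s. s \<in> \<eta> \<and> \<sigma> s \<in> \<eta>}"
    unfolding hop_sites_def by (subst card_Un_disjoint[symmetric]) (auto intro: arg_cong[where f=card])
  ultimately show ?thesis using c by simp
qed

text \<open>For a fixed \<open>s\<close>, hopping is a bijection from the configurations with a
  particle at \<open>s\<close> and a hole at \<open>\<sigma> s\<close> to those with the two
  exchanged. So each configuration is entered in as many ways as it has entry sites, and left in
  equally many.\<close>

lemma uniform_stationary: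
  fixes f :: "'s set \<Rightarrow> real"
  shows "(\<Sum>\<eta>\<in>UNIV. \<Sum>s\<in>hop_sites \<sigma> \<eta>. f (hop \<sigma> s \<eta>)) = (\<Sum>\<eta>\<in>UNIV. \<Sum>s\<in>hop_sites \<sigma> \<eta>. f \<eta>)"
proof -
  have "(\<Sum>\<eta>\<in>UNIV. \<Sum>s\<in>hop_sites \<sigma> \<eta>. f (hop \<sigma> s \<eta>))
      = (\<Sum>\<eta>\<in>UNIV. \<Sum>s\<in>{s\<in>UNIV. s \<in> \<eta> \<and> \<sigma> s \<notin> \<eta>}. f (hop \<sigma> s \<eta>))"
    by (simp add: hop_sites_def)
  also have "\<dots> = (\<Sum>s\<in>UNIV. \<Sum>\<eta>\<in>{\<eta>\<in>UNIV. s \<in> \<eta> \<and> \<sigma> s \<notin> \<eta>}. f (hop \<sigma> s \<eta>))"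
    by (rule sum.swap_restrict) auto
  also have "\<dots> = (\<Sum>s\<in>UNIV. \<Sum>\<eta>\<in>{\<eta>\<in>UNIV. s \<notin> \<eta> \<and> \<sigma> s \<in> \<eta>}. f \<eta>)"
  proof (rule sum.cong[OF refl])
    fix s
    show "(\<Sum>\<eta>\<in>{\<eta>\<in>UNIV. s \<in> \<eta> \<and> \<sigma> s \<notin> \<eta>}. f (hop \<sigma> s \<eta>))
        = (\<Sum>\<eta>\<in>{\<eta>\<in>UNIV. s \<notin> \<eta> \<and> \<sigma> s \<in> \<eta>}. f \<eta>)"
      by (rule sum.reindex_bij_witness[where i="\<lambda>\<eta>. insert s (\<eta> - {\<sigma> s})" and j="hop \<sigma> s"])
         (use shift_neq[of s] in \<open>auto simp: hop_def insert_absorb insert_commute\<close>)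
  qed
  also have "\<dots> = (\<Sum>\<eta>\<in>UNIV. \<Sum>s\<in>{s\<in>UNIV. s \<notin> \<eta> \<and> \<sigma> s \<in> \<eta>}. f \<eta>)"
    by (rule sum.swap_restrict) auto
  also have "\<dots> = (\<Sum>\<eta>\<in>UNIV. \<Sum>s\<in>hop_sites \<sigma> \<eta>. f \<eta>)"
    using card_entry_sites by simp
  finally show ?thesis .
qed

text \<open>A transposition of neighbouring sites acts on a configuration as a hop, as a reversed
  hop or trivially. Conjugating by neighbouring transpositions along the cycle produces all the
  others.\<close>

lemma hop_invariant_transpose:
  assumes inv: "\<And>\<eta> s. s \<in> hop_sites \<sigma> \<eta> \<Longrightarrow> y (hop \<sigma> s \<eta>) = y \<eta>"
  shows "y (Transposition.transpose s t ` \<eta>) = y \<eta>"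
proof -
  have adj: "y (Transposition.transpose s (\<sigma> s) ` \<eta>) = y \<eta>" for s \<eta>
  proof -
    let ?\<tau> = "Transposition.transpose s (\<sigma> s)"
    have "?\<tau> ` \<eta> = hop \<sigma> s \<eta>" if "s \<in> hop_sites \<sigma> \<eta>" for \<eta>
      using that shift_neq[of s]
      by (intro set_eqI) (auto simp: hop_sites_def hop_def Transposition.transpose_def image_iff split: if_splits)
    note hop = this
    consider "s \<in> hop_sites \<sigma> \<eta>" | "s \<notin> \<eta>" "\<sigma> s \<in> \<eta>" | "s \<in> \<eta> \<longleftrightarrow> \<sigma> s \<in> \<eta>"
      by (auto simp: hop_sites_def)
    then show ?thesis
    proof cases
      case 1
      then show ?thesis using hop inv by simp
    next
      case 2
      then have "s \<in> hop_sites \<sigma> (?\<tau> ` \<eta>)"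
        using shift_neq[of s] by (force simp: hop_sites_def Transposition.transpose_def image_iff)
      then have "y (?\<tau> ` ?\<tau> ` \<eta>) = y (?\<tau> ` \<eta>)" using hop inv by simp
      then show ?thesis by (simp add: image_comp)
    next
      case 3
      then have "?\<tau> ` \<eta> = \<eta>" by (simp add: transpose_image_eq)
      then show ?thesis by simp
    qed
  qed
  have "\<forall>\<eta>. y (Transposition.transpose s ((\<sigma> ^^ i) s) ` \<eta>) = y \<eta>" for i
  proof (induction i)
    case 0
    then show ?case by simp
  next
    case (Suc i)
    let ?b = "(\<sigma> ^^ i) s"
    show ?case
    proof (cases "s = ?b \<or> s = \<sigma> ?b")
      case True
      then show ?thesis using adj[of s] by auto
    next
      case False
      then have "Transposition.transpose s (\<sigma> ?b) = Transposition.transpose ?b (\<sigma> ?b) \<circ> Transposition.transpose s ?b \<circ> Transposition.transpose ?b (\<sigma> ?b)"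
        using shift_neq[of ?b] by (auto simp: fun_eq_iff Transposition.transpose_def)
      then have "Transposition.transpose s (\<sigma> ?b) ` \<eta> = Transposition.transpose ?b (\<sigma> ?b) ` (Transposition.transpose s ?b ` (Transposition.transpose ?b (\<sigma> ?b) ` \<eta>))" for \<eta>
        by (simp add: image_comp)
      then show ?thesis using Suc adj[of ?b] by simp
    qed
  qed
  then show ?thesis using single_orbit[of s t] by metis
qed

text \<open>Irreducibility of the process on configurations of a given size: transpositions act
  transitively on them, and each one used here shrinks \<open>\<eta> - \<eta>'\<close> by one
  element.\<close>

lemma hop_invariant_card:
  assumes inv: "\<And>\<eta> s. s \<in> hop_sites \<sigma> \<eta> \<Longrightarrow> y (hop \<sigma> s \<eta>) = y \<eta>"
    and "card \<eta> = card \<eta>'"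
  shows "y \<eta> = y \<eta>'"
  using assms(2)
proof (induction "card (\<eta> - \<eta>')" arbitrary: \<eta>)
  case 0
  then have "\<eta> \<subseteq> \<eta>'" by simp
  then have "\<eta> = \<eta>'" using 0 card_subset_eq[of \<eta>' \<eta>] by simp
  then show ?case by simp
next
  case (Suc m)
  from Suc.hyps(2) obtain s where s: "s \<in> \<eta> - \<eta>'"
    by (metis card.empty equals0I nat.distinct(1))
  have "\<not> \<eta>' \<subseteq> \<eta>"
    using s Suc.prems by (metis DiffD1 DiffD2 card_subset_eq finite)
  then obtain t where t: "t \<in> \<eta>' - \<eta>" by auto
  let ?\<zeta> = "Transposition.transpose s t ` \<eta>"
  have eq: "?\<zeta> = insert t (\<eta> - {s})"
    using s t by (force simp: Transposition.transpose_def image_iff)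
  have "?\<zeta> - \<eta>' = (\<eta> - \<eta>') - {s}" using s t eq by auto
  then have "card (?\<zeta> - \<eta>') = m" using Suc.hyps(2) s by simp
  moreover have "card ?\<zeta> = card \<eta>'"
    using Suc.prems by (simp add: card_image inj_on_subset[OF inj_on_transpose])
  ultimately have "y ?\<zeta> = y \<eta>'" using Suc.hyps(1) by simp
  then show ?case using hop_invariant_transpose[OF inv] by simp
qed

lemma card_subsets_separating:
  assumes "s \<noteq> (t::'s)" "k \<ge> 1"
  shows "card {\<eta>. card \<eta> = k \<and> s \<in> \<eta> \<and> t \<notin> \<eta>} = (CARD('s) - 2) choose (k - 1)"
proof -
  have "card {\<eta>. card \<eta> = k \<and> s \<in> \<eta> \<and> t \<notin> \<eta>} = card {\<zeta>. \<zeta> \<subseteq> UNIV - {s,t} \<and> card \<zeta> = k - 1}"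
    by (rule bij_betw_same_card[where f="\<lambda>\<eta>. \<eta> - {s}"], rule bij_betw_byWitness[where f'="insert s"])
       (use assms in \<open>auto simp: card_insert_if subset_iff\<close>)
  also have "\<dots> = card (UNIV - {s,t}) choose (k - 1)"
    by (rule n_subsets) simp
  also have "card (UNIV - {s,t}) = CARD('s) - 2"
    using assms by (simp add: card_Diff_subset)
  finally show ?thesis .
qed

text \<open>Count pairs of a configuration and a hop site the other way round: a site and its
  successor are separated by \<open>(n - 2) choose (k - 1)\<close> of the \<open>k\<close>-subsets,
  and two absorption identities compare \<open>n\<close> times this number with
  \<open>n choose k\<close>.\<close>

lemma sum_current:
  assumes "1 \<le> k" "k < CARD('s)"
  shows "(\<Sum>\<eta>\<in>{\<eta>. card \<eta> = k}. real (card (hop_sites \<sigma> \<eta>)))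
       = real (card {\<eta>::'s set. card \<eta> = k}) * mean_current (CARD('s)) k"
proof -
  define n where "n = CARD('s)"
  have n2: "n \<ge> 2" using card_ge_2 by (simp add: n_def)
  have cs: "card {\<eta>::'s set. card \<eta> = k} = n choose k"
    using n_subsets[of "UNIV::'s set" k] by (simp add: n_def)
  have "(\<Sum>\<eta>\<in>{\<eta>. card \<eta> = k}. real (card (hop_sites \<sigma> \<eta>)))
      = (\<Sum>\<eta>\<in>{\<eta>. card \<eta> = k}. \<Sum>s\<in>{s\<in>UNIV. s \<in> \<eta> \<and> \<sigma> s \<notin> \<eta>}. 1)"
    by (simp add: hop_sites_def)
  also have "\<dots> = (\<Sum>s\<in>UNIV. \<Sum>\<eta>\<in>{\<eta>\<in>{\<eta>. card \<eta> = k}. s \<in> \<eta> \<and> \<sigma> s \<notin> \<eta>}. 1)"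
    by (rule sum.swap_restrict) auto
  also have "\<dots> = (\<Sum>s\<in>(UNIV::'s set). real ((n - 2) choose (k - 1)))"
    using card_subsets_separating[OF shift_neq[symmetric] assms(1)]
    by (intro sum.cong) (auto simp: n_def conj_assoc)
  also have "\<dots> = real n * real ((n - 2) choose (k - 1))" by (simp add: n_def)
  also have "\<dots> = real (n choose k) * mean_current n k"
  proof -
    obtain m where m: "n = Suc (Suc m)" using le_Suc_ex[OF n2] by auto
    obtain j where j: "k = Suc j" using assms(1) by (cases k) auto
    have a: "Suc j * (Suc (Suc m) choose Suc j) = Suc (Suc m) * (Suc m choose j)"
      by (metis Suc_times_binomial_eq mult.commute)
    have b: "(Suc m - j) * (Suc m choose j) = Suc m * (m choose j)"
      using binomial_absorb_comp[of "Suc m" j] by simp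
    have jm: "j \<le> Suc m" using assms(2) j m n_def by simp
    have a': "real (Suc j) * real (n choose k) = real n * real (Suc m choose j)"
      using a unfolding m j by (metis of_nat_mult)
    have b': "(real (Suc m) - real j) * real (Suc m choose j) = real (Suc m) * real (m choose j)"
      using b jm by (metis of_nat_mult of_nat_diff)
    have "real (n choose k) * mean_current n k
        = (real (Suc j) * real (n choose k)) * (real (Suc m) - real j) / real (Suc m)"
      by (simp add: mean_current_def m j)
    also have "\<dots> = real n * ((real (Suc m) - real j) * real (Suc m choose j)) / real (Suc m)"
      unfolding a' by simp
    also have "\<dots> = real n * real (m choose j)" unfolding b' by simp
    finally show ?thesis by (simp add: m j)
  qed
  finally show ?thesis by (simp add: cs n_def)
qed

text \<open>The generator of the continuous-time process in which every possible hop has rate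
  one.\<close>

definition generator :: "('s set \<Rightarrow> real) \<Rightarrow> 's set \<Rightarrow> real" where
  "generator h \<eta> = (\<Sum>s\<in>hop_sites \<sigma> \<eta>. h (hop \<sigma> s \<eta>) - h \<eta>)"

text \<open>Pairing \<open>generator y\<close> with \<open>y\<close> gives minus the energy
  \<open>\<Sum> (y (hop s \<eta>) - y \<eta>)\<^sup>2 / 2\<close>, because the uniform measure is stationary.\<close>
lemma generator_energy:
  assumes "(\<Sum>\<eta>\<in>UNIV. generator y \<eta> * y \<eta>) = 0" "s \<in> hop_sites \<sigma> \<eta>"
  shows "y (hop \<sigma> s \<eta>) = y \<eta>"
proof -
  let ?E = "\<lambda>\<eta>. \<Sum>s\<in>hop_sites \<sigma> \<eta>. (y (hop \<sigma> s \<eta>) - y \<eta>)\<^sup>2"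
  \<comment> \<open>Expand \<open>(u - v)^2 = u^2 - v^2 - 2 v (u - v)\<close>; stationarity cancels
    the first two sums.\<close>
  have "(\<Sum>\<eta>\<in>UNIV. ?E \<eta>) = (\<Sum>\<eta>\<in>UNIV. \<Sum>s\<in>hop_sites \<sigma> \<eta>. (y (hop \<sigma> s \<eta>))\<^sup>2)
      - (\<Sum>\<eta>\<in>UNIV. \<Sum>s\<in>hop_sites \<sigma> \<eta>. (y \<eta>)\<^sup>2) - 2 * (\<Sum>\<eta>\<in>UNIV. generator y \<eta> * y \<eta>)"
    unfolding generator_def sum_distrib_left sum_distrib_right sum_subtractf[symmetric]
    by (intro sum.cong refl) (simp add: power2_eq_square algebra_simps)
  also have "\<dots> = 0"
    using uniform_stationary[of "\<lambda>\<eta>. (y \<eta>)\<^sup>2"] assms(1) by simp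
  finally have "(\<Sum>\<eta>\<in>UNIV. ?E \<eta>) = 0" .
  then have "?E \<eta> = 0"
    by (subst (asm) sum_nonneg_eq_0_iff) (auto intro: sum_nonneg)
  then have "(y (hop \<sigma> s \<eta>) - y \<eta>)\<^sup>2 = 0"
    using assms(2) by (subst (asm) sum_nonneg_eq_0_iff) auto
  then show ?thesis by simp
qed

text \<open>By the Fredholm alternative it is enough that the right-hand side, extended by 0 to the
  other sizes, is orthogonal to every \<open>y\<close> orthogonal to the range of the generator.
  Such a \<open>y\<close> has zero energy, hence is constant on the \<open>k\<close>-subsets, where
  the right-hand side has mean zero.\<close>

lemma poisson_equation:
  assumes "1 \<le> k" "k < CARD('s)"
  obtains h where "\<And>\<eta>. card \<eta> = k \<Longrightarrow>
    generator h \<eta> = real (card (hop_sites \<sigma> \<eta>)) - mean_current (CARD('s)) k"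
proof -
  define T :: "real ^ ('s set) \<Rightarrow> real ^ ('s set)" where
    "T h = (\<chi> \<eta>. generator (\<lambda>\<eta>. h $ \<eta>) \<eta>)" for h
  define g :: "real ^ ('s set)" where
    "g = (\<chi> \<eta>. if card \<eta> = k then real (card (hop_sites \<sigma> \<eta>)) - mean_current (CARD('s)) k else 0)"
  have "linear T"
    by (rule linearI)
       (simp_all add: T_def generator_def vec_eq_iff sum.distrib sum_subtractf algebra_simps flip: sum_distrib_left)
  moreover have "g \<bullet> y = 0" if orth: "\<And>x. T x \<bullet> y = 0" for y
  proof -
    \<comment> \<open>Of all the orthogonality relations only the one with \<open>x = y\<close> is
      used: it is the vanishing of the energy.\<close>
    have "(\<Sum>\<eta>\<in>UNIV. generator (\<lambda>\<eta>. y $ \<eta>) \<eta> * y $ \<eta>) = 0"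
      using orth[of y] by (simp add: T_def inner_vec_def)
    then have inv: "s \<in> hop_sites \<sigma> \<eta> \<Longrightarrow> y $ (hop \<sigma> s \<eta>) = y $ \<eta>" for s \<eta>
      using generator_energy[of "\<lambda>\<eta>. y $ \<eta>"] by simp
    obtain \<eta>0 :: "'s set" where \<eta>0: "card \<eta>0 = k"
      using assms(2) by (metis obtain_subset_with_card_n less_imp_le)
    have "g \<bullet> y = (\<Sum>\<eta>\<in>UNIV. if card \<eta> = k
        then (real (card (hop_sites \<sigma> \<eta>)) - mean_current (CARD('s)) k) * y $ \<eta> else 0)"
      unfolding inner_vec_def g_def by (intro sum.cong) auto
    also have "\<dots> = (\<Sum>\<eta>\<in>{\<eta>. card \<eta> = k}. (real (card (hop_sites \<sigma> \<eta>)) - mean_current (CARD('s)) k) * y $ \<eta>)"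
      by (subst sum.inter_filter[symmetric]) auto
    also have "\<dots> = (\<Sum>\<eta>\<in>{\<eta>. card \<eta> = k}. (real (card (hop_sites \<sigma> \<eta>)) - mean_current (CARD('s)) k) * y $ \<eta>0)"
      using hop_invariant_card[of "\<lambda>\<eta>. y $ \<eta>", OF inv] \<eta>0 by (intro sum.cong) auto
    also have "\<dots> = ((\<Sum>\<eta>\<in>{\<eta>. card \<eta> = k}. real (card (hop_sites \<sigma> \<eta>)))
        - real (card {\<eta>::'s set. card \<eta> = k}) * mean_current (CARD('s)) k) * y $ \<eta>0"
      by (simp add: sum_subtractf flip: sum_distrib_right)
    also have "\<dots> = 0" using sum_current[OF assms] by simp
    finally show ?thesis .
  qed
  ultimately have "g \<in> range T" by (rule orthogonal_imp_in_range)
  then obtain h where h: "g = T h" by auto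
  show thesis
  proof (rule that)
    fix \<eta> :: "'s set" assume "card \<eta> = k"
    then show "generator (\<lambda>\<eta>. h $ \<eta>) \<eta> = real (card (hop_sites \<sigma> \<eta>)) - mean_current (CARD('s)) k"
      using arg_cong[OF h, of "\<lambda>v. v $ \<eta>"] by (simp add: g_def T_def)
  qed
qed

end

section \<open>Encoding alcoves by places\<close>

text \<open>On the alcove coded by \<open>p\<close> this is the floor of \<open>x a - x c\<close>.
  For \<open>a < c\<close> inside the fundamental chamber it counts the hyperplanes
  \<open>x a - x c = d\<close> with \<open>d \<ge> 1\<close> that separate the alcove from the
  fundamental one.\<close>

definition level :: "('n::finite \<Rightarrow> int) \<Rightarrow> 'n \<Rightarrow> 'n \<Rightarrow> int" where
  "level p a c = (p a - p c) div int CARD('n)"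

text \<open>An alcove is encoded by the inverse \<open>p\<close> of its affine permutation: \<open>p a\<close> is the place of
  \<open>x a\<close> among all the reals \<open>x c + k\<close> with \<open>k\<close> an integer, and \<open>x c + k\<close> has place
  \<open>p c + n k\<close>. The second condition fixes the place of the origin.\<close>
definition alcove_code :: "('n::finite \<Rightarrow> int) \<Rightarrow> bool" where
  "alcove_code p \<longleftrightarrow> inj (\<lambda>a. p a mod int CARD('n)) \<and> (\<forall>a. p a = (\<Sum>c\<in>UNIV. level p a c))"

definition cell :: "('n::{finite,linorder} \<Rightarrow> int) \<Rightarrow> (real ^ 'n::{finite,linorder}) set" where
  "cell p = {y \<in> sum_zero_space. \<forall>a c. a \<noteq> c \<longrightarrow>
     of_int (level p a c) < y $ a - y $ c \<and> y $ a - y $ c < of_int (level p a c) + 1}"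

definition closed_cell :: "('n::{finite,linorder} \<Rightarrow> int) \<Rightarrow> (real ^ 'n::{finite,linorder}) set" where
  "closed_cell p = {y \<in> sum_zero_space. \<forall>a c. a \<noteq> c \<longrightarrow>
     of_int (level p a c) \<le> y $ a - y $ c \<and> y $ a - y $ c \<le> of_int (level p a c) + 1}"

text \<open>At this point the list of all \<open>x c + k\<close> is equally spaced with step
  \<open>1/n\<close>; the subtracted term is the mean of the \<open>p c / n\<close>. It serves as an
  explicit interior point and is not compared with \<open>central_point\<close>.\<close>

definition centre :: "('n::{finite,linorder} \<Rightarrow> int) \<Rightarrow> real ^ 'n::{finite,linorder}" where
  "centre p = (\<chi> a. of_int (p a) / real CARD('n) - of_int (\<Sum>c\<in>UNIV. p c) / (real CARD('n))\<^sup>2)"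

lemma level_refl [simp]: "level p a a = 0"
  by (simp add: level_def)

lemma mod_eq_iff_code:
  assumes "alcove_code (p :: 'n::finite \<Rightarrow> int)"
  shows "int CARD('n) dvd p a - p c \<longleftrightarrow> a = c"
  using assms by (auto simp: alcove_code_def inj_def mod_eq_dvd_iff)

lemma level_swap:
  assumes "alcove_code (p :: 'n::finite \<Rightarrow> int)" "a \<noteq> c"
  shows "level p c a = - level p a c - 1"
proof -
  have "\<not> int CARD('n) dvd p a - p c" using mod_eq_iff_code[OF assms(1)] assms(2) by simp
  then have "(- (p a - p c)) div int CARD('n) = - ((p a - p c) div int CARD('n)) - 1"
    by (subst zdiv_zminus1_eq_if) (auto simp: dvd_eq_mod_eq_0)
  then show ?thesis by (simp add: level_def)
qed

text \<open>Levels depend only on differences of places; the normalisation in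
  \<open>alcove_code\<close> recovers the places themselves as row sums.\<close>

lemma code_eqI:
  assumes "alcove_code p" "alcove_code q" "\<And>a c. a \<noteq> c \<Longrightarrow> level p a c = level q a c"
  shows "p = q"
proof
  fix a
  have "level p a c = level q a c" for c using assms(3)[of a c] by (cases "a = c") auto
  then have "(\<Sum>c\<in>UNIV. level p a c) = (\<Sum>c\<in>UNIV. level q a c)" by simp
  then show "p a = q a" using assms(1,2) by (simp add: alcove_code_def)
qed

lemma centre_diff: "centre (p :: 'n::{finite,linorder} \<Rightarrow> int) $ a - centre p $ c = of_int (p a - p c) / real CARD('n)"
  by (simp add: centre_def diff_divide_distrib)

lemma centre_in_sum_zero: "centre p \<in> sum_zero_space"
  by (simp add: sum_zero_space_def centre_def sum_subtractf power2_eq_square flip: sum_divide_distrib)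

lemma centre_in_cell:
  assumes "alcove_code (p :: 'n::{finite,linorder} \<Rightarrow> int)"
  shows "centre p \<in> cell p"
proof -
  have "of_int (level p a c) < of_int (p a - p c) / real CARD('n)"
       "of_int (p a - p c) / real CARD('n) < of_int (level p a c) + 1" if "a \<noteq> c" for a c
  proof -
    let ?n = "int CARD('n)" and ?d = "p a - p c"
    have nd: "?d mod ?n \<noteq> 0" using mod_eq_iff_code[OF assms, of a c] that by (simp add: dvd_eq_mod_eq_0)
    have "?d mod ?n \<ge> 0" "?d mod ?n < ?n" by simp_all
    moreover have "?d = ?n * level p a c + ?d mod ?n" by (simp add: level_def)
    ultimately have "?n * level p a c < ?d" "?d < ?n * level p a c + ?n" using nd by linarith+
    then have "real_of_int (?n * level p a c) < real_of_int ?d" "real_of_int ?d < real_of_int (?n * level p a c + ?n)"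
      by linarith+
    then show "of_int (level p a c) < of_int ?d / real CARD('n)"
       "of_int ?d / real CARD('n) < of_int (level p a c) + 1"
      by (simp_all add: field_simps)
  qed
  then show ?thesis using centre_in_sum_zero[of p] by (simp add: cell_def centre_diff)
qed

lemma cell_subset_closed_cell: "cell p \<subseteq> closed_cell p"
  by (auto simp: cell_def closed_cell_def less_imp_le)

lemma floor_diff_cell:
  assumes "y \<in> cell p"
  shows "\<lfloor>y $ a - y $ c\<rfloor> = level p a c"
  using assms by (cases "a = c") (auto simp: cell_def floor_eq_iff less_imp_le)

lemma cell_inject:
  assumes "alcove_code p" "alcove_code q" "cell p = cell q"
  shows "p = q"
proof (rule code_eqI[OF assms(1,2)])
  fix a c
  have "centre p \<in> cell p" "centre p \<in> cell q" using centre_in_cell[OF assms(1)] assms(3) by auto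
  then show "level p a c = level q a c" using floor_diff_cell by metis
qed

lemma hyperplanes_complement:
  "sum_zero_space - \<Union>hyperplanes = {y::real^'n::{finite,linorder}. y \<in> sum_zero_space \<and> (\<forall>a c. a \<noteq> c \<longrightarrow> y $ a - y $ c \<notin> \<int>)}"
  (is "?L = ?R")
proof
  show "?L \<subseteq> ?R"
  proof clarify
    fix y :: "(real, 'n) vec" and a c
    assume y: "y \<in> sum_zero_space" "y \<notin> \<Union>hyperplanes" and ac: "a \<noteq> c" and "y $ a - y $ c \<in> \<int>"
    then obtain d where d: "y $ a - y $ c = of_int d" by (auto elim: Ints_cases)
    have "y \<notin> {x \<in> sum_zero_space. x $ i - x $ j = of_int e}" if "i < j" for i j e
      using y(2) that unfolding hyperplanes_def by blast
    then have no: "y $ i - y $ j \<noteq> of_int e" if "i < j" for i j e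
      using y(1) that by blast
    show False
    proof (cases "a < c")
      case True
      then show ?thesis using no d by blast
    next
      case False
      then have "c < a" using ac by simp
      moreover have "y $ c - y $ a = of_int (- d)" using d by simp
      ultimately show ?thesis using no by blast
    qed
  qed
  show "?R \<subseteq> ?L"
    by (auto simp: hyperplanes_def) (metis Ints_of_int less_irrefl)
qed

lemma cell_subset_complement: "cell p \<subseteq> sum_zero_space - \<Union>hyperplanes"
proof -
  have "y $ a - y $ c \<notin> \<int>" if "y \<in> cell p" "a \<noteq> c" for y a c
  proof
    assume "y $ a - y $ c \<in> \<int>"
    then have "y $ a - y $ c = of_int (level p a c)"
      using floor_diff_cell[OF that(1), of a c] by (metis Ints_cases floor_of_int)
    moreover have "of_int (level p a c) < y $ a - y $ c" using that by (simp add: cell_def)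
    ultimately show False by simp
  qed
  then show ?thesis unfolding hyperplanes_complement by (auto simp: cell_def)
qed

lemma cell_cover:
  fixes x :: "real ^ 'n::{finite,linorder}"
  assumes "x \<in> sum_zero_space - \<Union>hyperplanes"
  obtains p where "alcove_code p" "x \<in> cell p"
proof -
  have ni: "x $ a - x $ c \<notin> \<int>" if "a \<noteq> c" for a c
    using assms that by (simp only: hyperplanes_complement) blast
  \<comment> \<open>\<open>P y\<close> is the signed count of the reals \<open>x c + k\<close> with
    \<open>k \<ge> 1\<close> that are \<open>\<le> y\<close>. It grows by \<open>n\<close> under a
    unit shift and increases strictly on reaching any such real, so
    \<open>x c + f < x a < x c + f + 1\<close> becomes
    \<open>p c + n f < p a < p c + n (f + 1)\<close>.\<close>
  define P where "P y = (\<Sum>c\<in>UNIV. \<lfloor>y - x $ c\<rfloor>)" for y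
  define p where "p a = P (x $ a)" for a
  let ?n = "int CARD('n)"
  have P_shift: "P (y + of_int k) = P y + ?n * k" for y k
  proof -
    have "\<lfloor>y + of_int k - x $ c\<rfloor> = \<lfloor>y - x $ c\<rfloor> + k" for c by linarith
    then show ?thesis by (simp add: P_def sum.distrib)
  qed
  have P_mono: "P y \<le> P z" if "y \<le> z" for y z
    unfolding P_def using that by (intro sum_mono floor_mono) simp
  have P_strict: "P y < P z" if "y \<le> z" "\<lfloor>y - x $ c\<rfloor> < \<lfloor>z - x $ c\<rfloor>" for y z c
    unfolding P_def using that by (intro sum_strict_mono_ex1) (auto intro: floor_mono)
  have lev: "level p a c = \<lfloor>x $ a - x $ c\<rfloor> \<and> (a \<noteq> c \<longrightarrow> \<not> ?n dvd p a - p c)" for a c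
  proof (cases "a = c")
    case False
    let ?f = "\<lfloor>x $ a - x $ c\<rfloor>"
    have lt: "x $ c + of_int ?f < x $ a"
    proof -
      have "x $ a - x $ c \<noteq> of_int ?f" using ni[OF False] by (metis Ints_of_int)
      then show ?thesis by linarith
    qed
    have "\<lfloor>x $ c + of_int ?f - x $ a\<rfloor> < \<lfloor>x $ a - x $ a\<rfloor>" using lt by simp
    then have 1: "p c + ?n * ?f < p a"
      unfolding p_def P_shift[symmetric] using lt by (intro P_strict[where c=a]) simp_all
    have "x $ a < x $ c + of_int (?f + 1)" by linarith
    moreover have "?f < \<lfloor>x $ c + of_int (?f + 1) - x $ c\<rfloor>" by simp
    ultimately have 2: "p a < p c + ?n * (?f + 1)"
      unfolding p_def P_shift[symmetric] by (intro P_strict[where c=c]) simp_all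
    have "(p a - p c) div ?n = ?f"
      using 1 2 by (intro int_div_pos_eq[where r="p a - p c - ?n * ?f"]) (auto simp: algebra_simps)
    moreover have "\<not> ?n dvd p a - p c"
    proof
      assume "?n dvd p a - p c"
      then have "p a - p c = ?n * ?f" using \<open>(p a - p c) div ?n = ?f\<close> by auto
      then show False using 1 by simp
    qed
    ultimately show ?thesis by (simp add: level_def)
  qed simp
  have "alcove_code p"
    unfolding alcove_code_def
  proof (intro conjI allI injI)
    fix a c assume "p a mod ?n = p c mod ?n"
    then show "a = c" using lev[of a c] by (auto simp: mod_eq_dvd_iff)
  next
    fix a show "p a = (\<Sum>c\<in>UNIV. level p a c)" using lev by (simp add: p_def P_def)
  qed
  moreover have "x \<in> cell p"
    unfolding cell_def
  proof (intro CollectI conjI allI impI)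
    show "x \<in> sum_zero_space" using assms by simp
    fix a c :: 'n assume "a \<noteq> c"
    then have "x $ a - x $ c \<noteq> of_int (level p a c)" using ni by (metis Ints_of_int)
    moreover have l: "level p a c = \<lfloor>x $ a - x $ c\<rfloor>" using lev by simp
    ultimately show "of_int (level p a c) < x $ a - x $ c" by linarith
    show "x $ a - x $ c < of_int (level p a c) + 1" using l by linarith
  qed
  ultimately show thesis by (rule that)
qed

section \<open>Cells as connected components, and their closures\<close>

lemma convex_sum_zero_space: "convex sum_zero_space"
  by (auto simp: convex_def sum_zero_space_def sum.distrib simp flip: sum_distrib_left)

lemma coordinate_diff_inner: "y $ a - y $ c = (axis a 1 - axis c 1) \<bullet> (y :: real ^ 'n::finite)"
  by (simp add: inner_diff_left inner_axis')

lemma convex_cell: "convex (cell p)"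
proof -
  have "cell p = sum_zero_space \<inter> (\<Inter>(a,c)\<in>{(a,c). a \<noteq> c}.
      {y. (axis a 1 - axis c 1) \<bullet> y > of_int (level p a c)} \<inter> {y. (axis a 1 - axis c 1) \<bullet> y < of_int (level p a c) + 1})"
    unfolding cell_def coordinate_diff_inner by auto
  then show ?thesis
    by (auto intro!: convex_Int convex_INT convex_sum_zero_space convex_halfspace_gt convex_halfspace_lt)
qed

lemma connected_avoids_Ints_floor:
  fixes T :: "real set"
  assumes "connected T" "T \<inter> \<int> = {}" "u \<in> T" "v \<in> T"
  shows "\<lfloor>u\<rfloor> = \<lfloor>v\<rfloor>"
proof -
  have "\<not> \<lfloor>u\<rfloor> < \<lfloor>v\<rfloor>" if "u \<in> T" "v \<in> T" for u v
  proof
    assume "\<lfloor>u\<rfloor> < \<lfloor>v\<rfloor>"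
    then have "u \<le> of_int \<lfloor>v\<rfloor>" "of_int \<lfloor>v\<rfloor> \<le> v" by linarith+
    then have "of_int \<lfloor>v\<rfloor> \<in> T" using assms(1) that connected_contains_Icc[of T u v] by auto
    then show False using assms(2) by auto
  qed
  then show ?thesis using assms(3,4) by (meson linorder_neqE)
qed

text \<open>A cell is convex, so it lies in one component. Conversely, by the intermediate value
  theorem no coordinate difference changes its floor along a connected set that avoids the
  hyperplanes, and the floors determine the cell.\<close>

lemma alcoves_eq: "(alcoves :: (real ^ 'n::{finite,linorder}) set set) = cell ` Collect alcove_code"
proof -
  let ?U = "sum_zero_space - \<Union>hyperplanes"
  have comp: "connected_component_set ?U x = cell p" if x: "x \<in> cell p" and p: "alcove_code p"
    for x :: "(real, 'n) vec" and p
  proof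
    show "cell p \<subseteq> connected_component_set ?U x"
      using x cell_subset_complement convex_connected[OF convex_cell]
      by (intro connected_component_maximal) auto
    show "connected_component_set ?U x \<subseteq> cell p"
    proof clarify
      fix y assume "connected_component ?U x y"
      then obtain T where T: "connected T" "T \<subseteq> ?U" "x \<in> T" "y \<in> T"
        by (auto simp: connected_component_def)
      have fl: "\<lfloor>x $ a - x $ c\<rfloor> = \<lfloor>y $ a - y $ c\<rfloor>" if "a \<noteq> c" for a c
      proof (rule connected_avoids_Ints_floor[where T="(\<lambda>y. y $ a - y $ c) ` T"])
        show "connected ((\<lambda>y. y $ a - y $ c) ` T)"
          by (intro connected_continuous_image continuous_intros T)
        show "(\<lambda>y. y $ a - y $ c) ` T \<inter> \<int> = {}"
          using T(2) that unfolding hyperplanes_complement by blast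
      qed (use T in auto)
      have yU: "y \<in> ?U" using T by blast
      show "y \<in> cell p"
        unfolding cell_def
      proof (intro CollectI conjI allI impI)
        show "y \<in> sum_zero_space" using yU by simp
        fix a c :: 'n assume ac: "a \<noteq> c"
        have l: "level p a c = \<lfloor>y $ a - y $ c\<rfloor>" using fl[OF ac] floor_diff_cell[OF x] by simp
        have "y $ a - y $ c \<notin> \<int>" using yU ac unfolding hyperplanes_complement by blast
        then have "y $ a - y $ c \<noteq> of_int (level p a c)" by (metis Ints_of_int)
        then show "of_int (level p a c) < y $ a - y $ c" using l by linarith
        show "y $ a - y $ c < of_int (level p a c) + 1" using l by linarith
      qed
    qed
  qed
  show ?thesis
  proof
    show "(alcoves :: (real, 'n) vec set set) \<subseteq> cell ` Collect alcove_code"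
    proof
      fix C :: "(real, 'n) vec set" assume "C \<in> alcoves"
      then obtain x where x: "x \<in> ?U" "C = connected_component_set ?U x"
        by (auto simp: alcoves_def components_def)
      obtain p where "alcove_code p" "x \<in> cell p" using cell_cover[OF x(1)] .
      then show "C \<in> cell ` Collect alcove_code" using comp x(2) by auto
    qed
    show "cell ` Collect alcove_code \<subseteq> (alcoves :: (real, 'n) vec set set)"
    proof clarify
      fix p :: "'n \<Rightarrow> int" assume p: "alcove_code p"
      have "cell p = connected_component_set ?U (centre p)"
        using comp[OF centre_in_cell[OF p] p] by simp
      moreover have "centre p \<in> ?U" using centre_in_cell[OF p] cell_subset_complement by blast
      ultimately show "cell p \<in> alcoves" by (auto simp: alcoves_def components_def)
    qed
  qed
qed

lemma closed_sum_zero_space: "closed (sum_zero_space :: (real ^ 'n::{finite,linorder}) set)"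
  unfolding sum_zero_space_def by (intro closed_Collect_eq continuous_intros)

lemma closed_closed_cell: "closed (closed_cell (p :: 'n::{finite,linorder} \<Rightarrow> int))"
proof -
  have "closed_cell p = sum_zero_space \<inter> (\<Inter>(a,c)\<in>{(a,c). a \<noteq> c}.
      {y. of_int (level p a c) \<le> y $ a - y $ c} \<inter> {y. y $ a - y $ c \<le> of_int (level p a c) + 1})"
    unfolding closed_cell_def by auto
  then show ?thesis
    by (auto intro!: closed_Int closed_INT closed_sum_zero_space closed_Collect_le continuous_intros)
qed

text \<open>Moving a point of the closed cell slightly towards the interior point
  \<open>centre p\<close> makes every inequality strict.\<close>

lemma closure_cell:
  assumes "alcove_code (p :: 'n::{finite,linorder} \<Rightarrow> int)"
  shows "closure (cell p) = closed_cell p"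
proof
  show "closure (cell p) \<subseteq> closed_cell p"
    using closure_minimal[OF cell_subset_closed_cell closed_closed_cell] .
  show "closed_cell p \<subseteq> closure (cell p)"
  proof
    fix z assume z: "z \<in> closed_cell p"
    define w where "w k = (1 - 1 / (real k + 1)) *\<^sub>R z + (1 / (real k + 1)) *\<^sub>R centre p" for k
    have "w k \<in> cell p" for k
      unfolding cell_def
    proof (intro CollectI conjI allI impI)
      have t: "0 < 1 / (real k + 1)" "0 \<le> 1 - 1 / (real k + 1)" by auto
      show "w k \<in> sum_zero_space"
        unfolding w_def using z t centre_in_sum_zero[of p]
        by (intro convexD[OF convex_sum_zero_space]) (auto simp: closed_cell_def)
      fix a c :: 'n assume ac: "a \<noteq> c"
      have zb: "of_int (level p a c) \<le> z $ a - z $ c" "z $ a - z $ c \<le> of_int (level p a c) + 1"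
        using z ac by (auto simp: closed_cell_def)
      have cb: "of_int (level p a c) < centre p $ a - centre p $ c" "centre p $ a - centre p $ c < of_int (level p a c) + 1"
        using centre_in_cell[OF assms] ac by (auto simp: cell_def)
      have eq: "w k $ a - w k $ c = (1 - 1 / (real k + 1)) * (z $ a - z $ c) + (1 / (real k + 1)) * (centre p $ a - centre p $ c)"
        by (simp add: w_def algebra_simps)
      show "of_int (level p a c) < w k $ a - w k $ c"
        using add_le_less_mono[OF mult_left_mono[OF zb(1) t(2)] mult_strict_left_mono[OF cb(1) t(1)]]
        unfolding eq by (simp add: algebra_simps)
      show "w k $ a - w k $ c < of_int (level p a c) + 1"
        using add_le_less_mono[OF mult_left_mono[OF zb(2) t(2)] mult_strict_left_mono[OF cb(2) t(1)]]
        unfolding eq by (simp add: algebra_simps)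
    qed
    moreover have "w \<longlonglongrightarrow> (1 - 0) *\<^sub>R z + 0 *\<^sub>R centre p"
      unfolding w_def using LIMSEQ_Suc[OF lim_1_over_n]
      by (intro tendsto_intros) (auto simp: add.commute)
    ultimately show "z \<in> closure (cell p)"
      unfolding closure_sequential by auto
  qed
qed

section \<open>Walls and adjacent alcoves\<close>

text \<open>The label \<open>b\<close> of the translate \<open>x b + k\<close> whose place is
  directly after that of \<open>x a\<close>.\<close>

definition next_label :: "('n::finite \<Rightarrow> int) \<Rightarrow> 'n \<Rightarrow> 'n" where
  "next_label p a = (THE b. int CARD('n) dvd p b - p a - 1)"

definition bump :: "('n::finite \<Rightarrow> int) \<Rightarrow> 'n \<Rightarrow> ('n \<Rightarrow> int)" where
  "bump p a = p(a := p a + 1, next_label p a := p (next_label p a) - 1)"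

text \<open>Here \<open>x a\<close> meets the next larger real of the list, the translate of
  \<open>x b\<close> by \<open>level p a b + 1\<close> with \<open>b = next_label p a\<close>.
  Naming a wall by the coordinate on its lower side gives exactly one name to each.\<close>

definition wall :: "('n::{finite,linorder} \<Rightarrow> int) \<Rightarrow> 'n \<Rightarrow> (real ^ 'n::{finite,linorder}) set" where
  "wall p a = {x \<in> sum_zero_space. x $ a - x $ next_label p a = of_int (level p a (next_label p a)) + 1}"

lemma code_occupies_residue:
  assumes "alcove_code (p :: 'n::finite \<Rightarrow> int)"
  shows "\<exists>b. int CARD('n) dvd p b - z"
proof -
  let ?n = "int CARD('n)" and ?r = "\<lambda>a. p a mod int CARD('n)"
  have "range ?r \<subseteq> {0..<?n}" by auto
  moreover have "inj ?r" using assms unfolding alcove_code_def by blast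
  then have "card (range ?r) = card {0..<?n}" by (simp add: card_image)
  ultimately have "range ?r = {0..<?n}" by (intro card_subset_eq) auto
  then have "z mod ?n \<in> range ?r" by simp
  then obtain b where "z mod ?n = p b mod ?n" by blast
  then show ?thesis by (metis mod_eq_dvd_iff)
qed

lemma next_label_iff:
  assumes "alcove_code (p :: 'n::finite \<Rightarrow> int)"
  shows "int CARD('n) dvd p b - p a - 1 \<longleftrightarrow> b = next_label p a"
proof -
  let ?n = "int CARD('n)"
  obtain b0 where b0: "?n dvd p b0 - p a - 1"
    using code_occupies_residue[OF assms, of "p a + 1"] by (auto simp: algebra_simps)
  have uniq: "b = b0" if "?n dvd p b - p a - 1" for b
  proof -
    have "?n dvd (p b - p a - 1) - (p b0 - p a - 1)" using that b0 by (rule dvd_diff)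
    also have "(p b - p a - 1) - (p b0 - p a - 1) = p b - p b0" by simp
    finally show ?thesis using mod_eq_iff_code[OF assms] by blast
  qed
  have "next_label p a = b0"
    unfolding next_label_def using b0 uniq by (rule the_equality)
  then show ?thesis using b0 uniq by blast
qed

lemma next_label_neq:
  assumes "alcove_code (p :: 'n::finite \<Rightarrow> int)" "CARD('n) \<ge> 2"
  shows "next_label p a \<noteq> a"
proof
  assume "next_label p a = a"
  then have "int CARD('n) dvd p a - p a - 1" using next_label_iff[OF assms(1)] by metis
  then have "int CARD('n) dvd 1" by simp
  then show False using assms(2) by simp
qed

text \<open>\<open>p a - p b\<close> is congruent to \<open>- 1\<close>, so its remainder is
  \<open>n - 1\<close> and adding one completes a multiple of \<open>n\<close>.\<close>

lemma next_label_place: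
  assumes "alcove_code (p :: 'n::finite \<Rightarrow> int)" "CARD('n) \<ge> 2"
  shows "p a - p (next_label p a) + 1 = int CARD('n) * (level p a (next_label p a) + 1)"
proof -
  let ?n = "int CARD('n)" and ?b = "next_label p a"
  have "?n dvd p ?b - p a - 1" using next_label_iff[OF assms(1)] by blast
  then have "?n dvd - (p ?b - p a - 1)" by (simp only: dvd_minus_iff)
  then have "?n dvd p a - p ?b + 1" by (simp add: algebra_simps)
  then obtain m where m: "p a - p ?b + 1 = ?n * m" by (rule dvdE)
  have "level p a ?b = m - 1"
    unfolding level_def using m assms(2)
    by (intro int_div_pos_eq[where r="?n - 1"]) (auto simp: algebra_simps)
  then show ?thesis using m by simp
qed

lemma bump_same [simp]: "CARD('n) \<ge> 2 \<Longrightarrow> alcove_code p \<Longrightarrow> bump p a a = p (a :: 'n::finite) + 1"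
  using next_label_neq[of p a] by (simp add: bump_def)

lemma bump_next [simp]: "bump p a (next_label p a) = p (next_label p a) - 1"
  by (simp add: bump_def)

lemma bump_other [simp]: "c \<noteq> a \<Longrightarrow> c \<noteq> next_label p a \<Longrightarrow> bump p a c = p c"
  by (simp add: bump_def)

lemma div_plus_one: "n > 0 \<Longrightarrow> \<not> n dvd x + 1 \<Longrightarrow> (x + 1) div n = x div (n::int)"
proof -
  assume n: "n > 0" and nd: "\<not> n dvd x + 1"
  have x: "x = n * (x div n) + x mod n" by simp
  have "x mod n \<noteq> n - 1"
  proof
    assume "x mod n = n - 1"
    then have "(x + 1) mod n = (n - 1 + 1) mod n" by (metis mod_add_left_eq)
    then show False using nd by (simp add: dvd_eq_mod_eq_0)
  qed
  moreover have "0 \<le> x mod n" "x mod n < n" using n by simp_all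
  ultimately show ?thesis
    by (intro int_div_pos_eq[where r="x mod n + 1"]) auto
qed

lemma div_minus_one: "n > 0 \<Longrightarrow> \<not> n dvd x \<Longrightarrow> (x - 1) div n = x div (n::int)"
  using div_plus_one[of n "x - 1"] by simp

text \<open>Crossing a wall crosses one hyperplane only. For a pair containing just one of the two
  exchanged labels, the difference of places changes by one, but distinct residues keep the quotient
  by \<open>n\<close> unchanged.\<close>

lemma level_bump:
  fixes p :: "'n::finite \<Rightarrow> int"
  assumes p: "alcove_code p" and n2: "CARD('n) \<ge> 2" and ij: "i \<noteq> j"
  shows "level (bump p a) i j = level p i j +
    (if i = a \<and> j = next_label p a then 1 else if i = next_label p a \<and> j = a then - 1 else 0)"
proof -
  let ?n = "int CARD('n)" and ?b = "next_label p a"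
  have n: "?n > 0" "?n \<ge> 2" using n2 by auto
  have ab: "?b \<noteq> a" using next_label_neq[OF p n2] .
  have place: "p a - p ?b + 1 = ?n * (level p a ?b + 1)" by (rule next_label_place[OF p n2])
  have eq: "?n dvd p x - p y \<longleftrightarrow> x = y" for x y using mod_eq_iff_code[OF p] .
  have nx: "?n dvd p x - p a - 1 \<longleftrightarrow> x = ?b" for x using next_label_iff[OF p] .
  have nx': "?n dvd p x - p ?b + 1 \<longleftrightarrow> x = a" for x
  proof -
    have "?n dvd p ?b - p a - 1" using nx by simp
    moreover have "p x - p a = (p x - p ?b + 1) + (p ?b - p a - 1)" by simp
    ultimately have "?n dvd p x - p ?b + 1 \<longleftrightarrow> ?n dvd p x - p a" by (metis dvd_add_left_iff)
    then show ?thesis using eq by simp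
  qed
  have down: "level (bump p a) ?b a = level p ?b a - 1"
  proof -
    have l: "level p ?b a = - level p a ?b - 1" using level_swap[OF p ab[symmetric]] .
    have "level (bump p a) ?b a = - level p a ?b - 2"
      unfolding level_def[of "bump p a"] using place n2 ab p n
      by (intro int_div_pos_eq[where r="?n - 1"]) (auto simp: algebra_simps)
    then show ?thesis using l by simp
  qed
  have up: "level (bump p a) a ?b = level p a ?b + 1"
    unfolding level_def[of "bump p a"] using place n2 ab p n
    by (intro int_div_pos_eq[where r="1"]) (auto simp: algebra_simps)
  consider "i = a" "j = ?b" | "i = ?b" "j = a" | "i = a" "j \<noteq> ?b" | "i = ?b" "j \<noteq> a"
    | "j = a" "i \<noteq> ?b" | "j = ?b" "i \<noteq> a" | "i \<noteq> a" "i \<noteq> ?b" "j \<noteq> a" "j \<noteq> ?b" by blast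
  then show ?thesis
  proof cases
    case 1
    then show ?thesis using up by simp
  next
    case 2
    then show ?thesis using down ab by simp
  next
    case 3
    have "?n dvd (p a - p j) + 1 \<longleftrightarrow> ?n dvd - ((p a - p j) + 1)" by (simp only: dvd_minus_iff)
    also have "- ((p a - p j) + 1) = p j - p a - 1" by simp
    finally have "\<not> ?n dvd (p a - p j) + 1" using nx 3 by simp
    then have "((p a - p j) + 1) div ?n = (p a - p j) div ?n" by (rule div_plus_one[OF n(1)])
    then show ?thesis using 3 ab ij p n2 by (simp add: level_def algebra_simps)
  next
    case 4
    have "\<not> ?n dvd p ?b - p j" using eq 4 ij by simp
    then have "((p ?b - p j) - 1) div ?n = (p ?b - p j) div ?n" by (rule div_minus_one[OF n(1)])
    then show ?thesis using 4 ab ij p n2 by (simp add: level_def algebra_simps)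
  next
    case 5
    have "\<not> ?n dvd p i - p a" using eq 5 ij by simp
    then have "((p i - p a) - 1) div ?n = (p i - p a) div ?n" by (rule div_minus_one[OF n(1)])
    then show ?thesis using 5 ab ij p n2 by (simp add: level_def algebra_simps)
  next
    case 6
    have "\<not> ?n dvd (p i - p ?b) + 1" using nx' 6 by simp
    then have "((p i - p ?b) + 1) div ?n = (p i - p ?b) div ?n" by (rule div_plus_one[OF n(1)])
    then show ?thesis using 6 ab ij p n2 by (simp add: level_def algebra_simps)
  next
    case 7
    then show ?thesis by (simp add: level_def)
  qed
qed

text \<open>Modulo \<open>n\<close> a crossing is composition with a transposition of labels. This
  preserves distinctness of residues here and describes the particle configuration later.\<close>

lemma bump_residue:
  fixes p :: "'n::finite \<Rightarrow> int"
  assumes p: "alcove_code p" and n2: "CARD('n) \<ge> 2"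
  shows "int CARD('n) dvd bump p a x - p (Transposition.transpose a (next_label p a) x)"
proof -
  let ?n = "int CARD('n)" and ?b = "next_label p a"
  have nb: "?n dvd p ?b - p a - 1" using next_label_iff[OF p] by simp
  consider "x = a" | "x = ?b" | "x \<noteq> a" "x \<noteq> ?b" by blast
  then show ?thesis
  proof cases
    case 1
    have "?n dvd - (p ?b - p a - 1)" using nb by (simp only: dvd_minus_iff)
    then show ?thesis using 1 p n2 by (simp add: algebra_simps)
  next
    case 2
    then show ?thesis using nb by (simp add: algebra_simps)
  qed simp_all
qed

lemma alcove_code_bump:
  fixes p :: "'n::finite \<Rightarrow> int"
  assumes p: "alcove_code p" and n2: "CARD('n) \<ge> 2"
  shows "alcove_code (bump p a)"
  unfolding alcove_code_def
proof (intro conjI allI injI)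
  let ?n = "int CARD('n)" and ?\<tau> = "Transposition.transpose a (next_label p a)"
  fix x y assume "bump p a x mod ?n = bump p a y mod ?n"
  then have "p (?\<tau> x) mod ?n = p (?\<tau> y) mod ?n"
    using bump_residue[OF p n2, of a x] bump_residue[OF p n2, of a y] by (metis mod_eq_dvd_iff)
  then have "?\<tau> x = ?\<tau> y" using p by (auto simp: alcove_code_def inj_def)
  then show "x = y" by (metis transpose_involutory)
next
  fix i
  let ?b = "next_label p a"
  have ab: "?b \<noteq> a" using next_label_neq[OF p n2] .
  \<comment> \<open>Row \<open>a\<close> of the levels gains 1 and row \<open>next_label p a\<close>
    loses 1, just as the places do, so the normalisation persists.\<close>
  have "level (bump p a) i j = level p i j + (if j = ?b then if i = a then 1 else 0 else 0)
      + (if j = a then if i = ?b then - 1 else 0 else 0)" for j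
    using level_bump[OF p n2, of i j a] ab by (cases "i = j") auto
  then have "(\<Sum>j\<in>UNIV. level (bump p a) i j) = p i + (if i = a then 1 else 0) + (if i = ?b then - 1 else 0)"
    using p by (simp add: sum.distrib alcove_code_def)
  also have "\<dots> = bump p a i" using ab by (auto simp: bump_def)
  finally show "bump p a i = (\<Sum>j\<in>UNIV. level (bump p a) i j)" by simp
qed

lemma next_label_bump:
  fixes p :: "'n::finite \<Rightarrow> int"
  assumes p: "alcove_code p" and n2: "CARD('n) \<ge> 2"
  shows "next_label (bump p a) (next_label p a) = a"
proof -
  let ?b = "next_label p a"
  have "int CARD('n) dvd - (p ?b - p a - 1)" using next_label_iff[OF p] by (simp only: dvd_minus_iff)
  then have "int CARD('n) dvd bump p a a - bump p a ?b - 1"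
    using p n2 by (simp add: algebra_simps)
  then show ?thesis using next_label_iff[OF alcove_code_bump[OF p n2]] by metis
qed

text \<open>The order of the whole list follows from comparing consecutive places. The inequality
  between \<open>y a\<close> and \<open>y c + f\<close> is chained along the places in between, by
  induction on their distance, so \<open>n\<close> inequalities suffice.\<close>

lemma closed_cell_iff_next:
  fixes p :: "'n::{finite,linorder} \<Rightarrow> int"
  assumes p: "alcove_code p" and n2: "CARD('n) \<ge> 2"
  shows "y \<in> closed_cell p \<longleftrightarrow> y \<in> sum_zero_space \<and>
    (\<forall>a. y $ a - y $ next_label p a \<le> of_int (level p a (next_label p a)) + 1)" (is "?L \<longleftrightarrow> ?R")
proof
  assume L: ?L
  have "y $ a - y $ next_label p a \<le> of_int (level p a (next_label p a)) + 1" for a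
    using L next_label_neq[OF p n2, of a] unfolding closed_cell_def by (metis (mono_tags, lifting) mem_Collect_eq)
  moreover have "y \<in> sum_zero_space" using L by (simp add: closed_cell_def)
  ultimately show ?R by simp
next
  assume R: ?R
  let ?n = "int CARD('n)"
  have chain: "y $ a \<le> y $ c + of_int f" if "p c + ?n * f - p a = int m" for a c f m
    using that
  proof (induction m arbitrary: a f)
    case 0
    have "p a - p c = ?n * f" using 0 by simp
    then have "?n dvd p a - p c" by simp
    then have ac: "a = c" using mod_eq_iff_code[OF p] by blast
    then have "f = 0" using \<open>p a - p c = ?n * f\<close> by simp
    then show ?case using ac by simp
  next
    case (Suc m)
    let ?b = "next_label p a"
    have pl: "p a - p ?b + 1 = ?n * (level p a ?b + 1)" by (rule next_label_place[OF p n2])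
    have "p c + ?n * (f - (level p a ?b + 1)) - p ?b = int m"
      using Suc.prems pl unfolding right_diff_distrib by linarith
    then have "y $ ?b \<le> y $ c + of_int (f - (level p a ?b + 1))" by (rule Suc.IH)
    moreover have "y $ a - y $ ?b \<le> of_int (level p a ?b) + 1" using R by simp
    ultimately show ?case by simp
  qed
  have le: "y $ a \<le> y $ c + of_int f" if "p a \<le> p c + ?n * f" for a c f
    using chain[of c f a "nat (p c + ?n * f - p a)"] that by simp
  show ?L
    unfolding closed_cell_def
  proof (intro CollectI conjI allI impI)
    show "y \<in> sum_zero_space" using R by simp
    fix a c :: 'n
    let ?f = "level p a c"
    define r where "r = (p a - p c) mod ?n"
    have "p a - p c = ?n * ?f + r" by (simp add: level_def r_def)
    moreover have "0 \<le> r" "r < ?n" by (simp_all add: r_def)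
    ultimately have "p c \<le> p a + (- (?n * ?f))" "p a \<le> p c + (?n * ?f + ?n)" by linarith+
    then have e: "p c \<le> p a + ?n * (- ?f)" "p a \<le> p c + ?n * (?f + 1)"
      by (simp_all only: distrib_left mult_minus_right mult_1_right)
    have "y $ c \<le> y $ a + of_int (- ?f)" using e(1) by (rule le)
    moreover have "y $ a \<le> y $ c + of_int (?f + 1)" using e(2) by (rule le)
    ultimately show "of_int ?f \<le> y $ a - y $ c" "y $ a - y $ c \<le> of_int ?f + 1"
      by simp_all
  qed
qed

text \<open>The centre of the neighbouring alcove violates exactly one of the \<open>n\<close>
  inequalities. Hence none of the half-spaces is redundant, which the description of the facets of a
  polyhedron requires.\<close>

lemma centre_bump_gap:
  fixes p :: "'n::{finite,linorder} \<Rightarrow> int"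
  assumes p: "alcove_code p" and n2: "CARD('n) \<ge> 2"
  shows "centre (bump p a) $ c - centre (bump p a) $ next_label p c \<le> of_int (level p c (next_label p c)) + 1 \<longleftrightarrow> c \<noteq> a"
proof -
  have c: "centre (bump p a) \<in> cell (bump p a)" using centre_in_cell[OF alcove_code_bump[OF p n2]] .
  have ne: "c \<noteq> next_label p c" for c using next_label_neq[OF p n2, of c] by simp
  let ?l = "level p c (next_label p c)" and ?l' = "level (bump p a) c (next_label p c)"
  have b: "of_int ?l' < centre (bump p a) $ c - centre (bump p a) $ next_label p c"
    "centre (bump p a) $ c - centre (bump p a) $ next_label p c < of_int ?l' + 1"
    using c ne[of c] unfolding cell_def by blast+
  show ?thesis
  proof (cases "c = a")
    case True
    then have "?l' = ?l + 1" using level_bump[OF p n2 ne[of c], of a] by simp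
    then show ?thesis using b True by simp
  next
    case False
    then have "?l' \<le> ?l" using level_bump[OF p n2 ne[of c], of a] by simp
    then have "of_int ?l' \<le> (of_int ?l :: real)" by simp
    then show ?thesis using b False by linarith
  qed
qed

lemma facet_of_closed_cell:
  fixes p :: "'n::{finite,linorder} \<Rightarrow> int"
  assumes p: "alcove_code p" and n2: "CARD('n) \<ge> 2"
  shows "F facet_of closed_cell p \<longleftrightarrow> (\<exists>a. F = closed_cell p \<inter> wall p a)"
    and "polyhedron (closed_cell p)"
proof -
  let ?S = "closed_cell p"
  define u where "u a = axis a 1 - axis (next_label p a) (1::real)" for a
  define d where "d a = of_int (level p a (next_label p a)) + (1::real)" for a
  define H where "H a = {x. u a \<bullet> x \<le> d a}" for a
  have H_iff: "x \<in> H a \<longleftrightarrow> x $ a - x $ next_label p a \<le> d a" for x a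
    by (simp add: H_def u_def coordinate_diff_inner)
  have S_eq: "?S = sum_zero_space \<inter> \<Inter>(range H)"
    using closed_cell_iff_next[OF p n2] by (auto simp: H_iff d_def)
  have out: "centre (bump p a) \<in> H c \<longleftrightarrow> c \<noteq> a" for a c
    using centre_bump_gap[OF p n2] by (simp add: H_iff d_def)
  have inj: "inj H"
    by (rule injI) (use out in blast)
  have V: "affine hull (sum_zero_space :: (real, 'n) vec set) = sum_zero_space"
  proof -
    have "subspace (sum_zero_space :: (real, 'n) vec set)"
      by (auto simp: subspace_def sum_zero_space_def sum.distrib simp flip: sum_distrib_left)
    then show ?thesis by (simp add: subspace_imp_affine affine_hull_eq)
  qed
  \<comment> \<open>The cell is nonempty and relatively open in \<open>sum_zero_space\<close>, so it
    spans that space, and so does its closure.\<close>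
  have "cell p = sum_zero_space \<inter> (\<Inter>(a,c)\<in>{(a,c). a \<noteq> c}.
      {y. of_int (level p a c) < y $ a - y $ c} \<inter> {y. y $ a - y $ c < of_int (level p a c) + 1})"
    unfolding cell_def by auto
  moreover have "open (\<Inter>(a,c)\<in>{(a,c). a \<noteq> c}.
      {y::(real, 'n) vec. of_int (level p a c) < y $ a - y $ c} \<inter> {y. y $ a - y $ c < of_int (level p a c) + 1})"
    by (intro open_INT) (auto intro!: open_Int open_Collect_less continuous_intros)
  ultimately have op: "openin (top_of_set (affine hull sum_zero_space)) (cell p)"
    unfolding V openin_open by blast
  have hull: "affine hull ?S = sum_zero_space"
    using affine_hull_openin[OF op] centre_in_cell[OF p] closure_same_affine_hull[of "cell p"] closure_cell[OF p] V by auto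
  show "polyhedron ?S"
    unfolding polyhedron_Int_affine
  proof (intro exI[of _ "range H"] conjI ballI)
    show "?S = affine hull ?S \<inter> \<Inter> (range H)" using S_eq hull by simp
    fix h assume "h \<in> range H"
    then obtain a where "h = H a" by auto
    moreover have "u a \<noteq> 0" using next_label_neq[OF p n2, of a] by (auto simp: u_def axis_eq_axis)
    ultimately show "\<exists>a b. a \<noteq> 0 \<and> h = {x. a \<bullet> x \<le> b}" unfolding H_def by blast
  qed simp
  have "F facet_of ?S \<longleftrightarrow> (\<exists>h. h \<in> range H \<and> F = ?S \<inter> {x. u (inv H h) \<bullet> x = d (inv H h)})"
  proof (rule facet_of_polyhedron_explicit)
    show "finite (range H)" by simp
    show "?S = affine hull ?S \<inter> \<Inter> (range H)" using S_eq hull by simp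
    show "u (inv H h) \<noteq> 0 \<and> h = {x. u (inv H h) \<bullet> x \<le> d (inv H h)}" if "h \<in> range H" for h
    proof -
      from that obtain a where a: "h = H a" by blast
      moreover have "u a \<noteq> 0" using next_label_neq[OF p n2, of a] by (auto simp: u_def axis_eq_axis)
      moreover have "inv H h = a" using inj a by simp
      ultimately show ?thesis by (simp add: H_def)
    qed
    fix F' assume F': "F' \<subset> range H"
    then obtain a where a: "H a \<notin> F'" by blast
    let ?q = "centre (bump p a)"
    have "?q \<in> h" if "h \<in> F'" for h
      using F' a that out by (metis imageE psubsetD)
    then have "?q \<in> affine hull ?S \<inter> \<Inter>F'" using hull centre_in_sum_zero by auto
    moreover have "?q \<notin> ?S" using S_eq out by auto
    moreover have "?S \<subseteq> affine hull ?S \<inter> \<Inter>F'" using S_eq hull F' by blast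
    ultimately show "?S \<subset> affine hull ?S \<inter> \<Inter>F'" by blast
  qed
  also have "\<dots> \<longleftrightarrow> (\<exists>a. F = ?S \<inter> {x. u a \<bullet> x = d a})"
    using inj by (auto simp: bex_simps)
  also have "\<dots> \<longleftrightarrow> (\<exists>a. F = ?S \<inter> wall p a)"
  proof -
    have "?S \<inter> {x. u a \<bullet> x = d a} = ?S \<inter> wall p a" for a
      by (auto simp: wall_def u_def d_def coordinate_diff_inner closed_cell_def)
    then show ?thesis by simp
  qed
  finally show "F facet_of ?S \<longleftrightarrow> (\<exists>a. F = ?S \<inter> wall p a)" .
qed

text \<open>A witness in the interior of the facet: it lies in the closed cell and on the hyperplane
  of this wall but on no other one, so it tells walls apart.\<close>

definition wall_point :: "('n::{finite,linorder} \<Rightarrow> int) \<Rightarrow> 'n \<Rightarrow> real ^ 'n::{finite,linorder}" where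
  "wall_point p a = midpoint (centre p) (centre (bump p a))"

lemma wall_point_in_wall:
  fixes p :: "'n::{finite,linorder} \<Rightarrow> int"
  assumes p: "alcove_code p" and n2: "CARD('n) \<ge> 2"
  shows "wall_point p a \<in> wall p a"
proof -
  let ?b = "next_label p a"
  have "wall_point p a \<in> sum_zero_space"
    unfolding wall_point_def midpoint_def scaleR_add_right
    by (rule convexD[OF convex_sum_zero_space]) (auto simp: centre_in_sum_zero)
  moreover have "wall_point p a $ a - wall_point p a $ ?b
      = ((centre p $ a - centre p $ ?b) + (centre (bump p a) $ a - centre (bump p a) $ ?b)) / 2"
    by (simp add: wall_point_def midpoint_def field_simps)
  moreover have "\<dots> = of_int (p a - p ?b + 1) / real CARD('n)"
    unfolding centre_diff using p n2 by (simp add: field_simps)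
  moreover have "\<dots> = of_int (level p a ?b) + 1"
    unfolding next_label_place[OF p n2] by simp
  ultimately show ?thesis by (simp add: wall_def)
qed

lemma wall_point_strict:
  fixes p :: "'n::{finite,linorder} \<Rightarrow> int"
  assumes p: "alcove_code p" and n2: "CARD('n) \<ge> 2" and ij: "i \<noteq> j"
    and out: "\<not> (i = a \<and> j = next_label p a)" "\<not> (i = next_label p a \<and> j = a)"
  shows "of_int (level p i j) < wall_point p a $ i - wall_point p a $ j"
    "wall_point p a $ i - wall_point p a $ j < of_int (level p i j) + 1"
proof -
  have l: "level (bump p a) i j = level p i j" using level_bump[OF p n2 ij, of a] out by auto
  have eq: "wall_point p a $ i - wall_point p a $ j
      = ((centre p $ i - centre p $ j) + (centre (bump p a) $ i - centre (bump p a) $ j)) / 2"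
    by (simp add: wall_point_def midpoint_def field_simps)
  have "centre p \<in> cell p" "centre (bump p a) \<in> cell (bump p a)"
    by (intro centre_in_cell alcove_code_bump p n2)+
  then have "of_int (level p i j) < centre p $ i - centre p $ j"
    "centre p $ i - centre p $ j < of_int (level p i j) + 1"
    "of_int (level p i j) < centre (bump p a) $ i - centre (bump p a) $ j"
    "centre (bump p a) $ i - centre (bump p a) $ j < of_int (level p i j) + 1"
    using ij l by (simp_all add: cell_def) (metis l)+
  then show "of_int (level p i j) < wall_point p a $ i - wall_point p a $ j"
    "wall_point p a $ i - wall_point p a $ j < of_int (level p i j) + 1"
    unfolding eq by auto
qed

lemma wall_point_in_closed_cell:
  fixes p :: "'n::{finite,linorder} \<Rightarrow> int"
  assumes p: "alcove_code p" and n2: "CARD('n) \<ge> 2"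
  shows "wall_point p a \<in> closed_cell p"
  unfolding closed_cell_iff_next[OF p n2]
proof (intro conjI allI)
  show "wall_point p a \<in> sum_zero_space" using wall_point_in_wall[OF p n2] by (auto simp: wall_def)
  fix c
  have ne: "c \<noteq> next_label p c" using next_label_neq[OF p n2, of c] by simp
  consider "c = a" | "c \<noteq> a" "\<not> (c = next_label p a \<and> next_label p c = a)" | "c = next_label p a" "next_label p c = a" by blast
  then show "wall_point p a $ c - wall_point p a $ next_label p c \<le> of_int (level p c (next_label p c)) + 1"
  proof cases
    case 1
    then show ?thesis using wall_point_in_wall[OF p n2, of a] by (simp add: wall_def)
  next
    case 2
    then show ?thesis using wall_point_strict[OF p n2 ne, of a] by auto
  next
    \<comment> \<open>Two labels that follow each other force \<open>n = 2\<close>, where both walls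
      bound the same coordinate difference.\<close>
    case 3
    have "level p c a = - level p a c - 1" using level_swap[OF p, of a c] 3 ne by auto
    then show ?thesis using wall_point_in_wall[OF p n2, of a] 3 by (simp add: wall_def)
  qed
qed

lemma wall_in_hyperplanes:
  fixes p :: "'n::{finite,linorder} \<Rightarrow> int"
  assumes p: "alcove_code p" and n2: "CARD('n) \<ge> 2"
  shows "wall p a \<in> hyperplanes"
proof (cases "a < next_label p a")
  case True
  have "wall p a = {x \<in> sum_zero_space. x $ a - x $ next_label p a = of_int (level p a (next_label p a) + 1)}"
    by (simp add: wall_def)
  then show ?thesis using True unfolding hyperplanes_def by blast
next
  case False
  then have lt: "next_label p a < a" using next_label_neq[OF p n2, of a] by auto
  have "wall p a = {x \<in> sum_zero_space. x $ next_label p a - x $ a = of_int (- (level p a (next_label p a) + 1))}"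
    by (auto simp: wall_def)
  then show ?thesis using lt unfolding hyperplanes_def by blast
qed

lemma wall_point_integral_diff:
  fixes p :: "'n::{finite,linorder} \<Rightarrow> int"
  assumes p: "alcove_code p" and n2: "CARD('n) \<ge> 2"
    and ij: "i \<noteq> j" and d: "wall_point p a $ i - wall_point p a $ j = of_int d"
  shows "i = a \<and> j = next_label p a \<and> d = level p a (next_label p a) + 1 \<or>
    i = next_label p a \<and> j = a \<and> d = - (level p a (next_label p a) + 1)"
proof -
  let ?b = "next_label p a" and ?m = "wall_point p a"
  have w: "?m $ a - ?m $ ?b = of_int (level p a ?b + 1)"
    using wall_point_in_wall[OF p n2, of a] by (simp add: wall_def)
  have "i = a \<and> j = ?b \<or> i = ?b \<and> j = a"
  proof (rule ccontr)
    assume "\<not> (i = a \<and> j = ?b \<or> i = ?b \<and> j = a)"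
    then have "of_int (level p i j) < (of_int d :: real)" "(of_int d :: real) < of_int (level p i j) + 1"
      using wall_point_strict[OF p n2, of i j a] ij d by auto
    then have "of_int (level p i j) < (of_int d :: real)" "(of_int d :: real) < of_int (level p i j + 1)" by simp_all
    then show False unfolding of_int_less_iff by simp
  qed
  then show ?thesis
  proof
    assume *: "i = a \<and> j = ?b"
    then have "d = level p a ?b + 1" using d w by (metis of_int_eq_iff)
    then show ?thesis using * by simp
  next
    assume *: "i = ?b \<and> j = a"
    then have "(of_int d :: real) = of_int (- (level p a ?b + 1))" using d w by simp
    then have "d = - (level p a ?b + 1)" by (metis of_int_eq_iff)
    then show ?thesis using * by simp
  qed
qed

lemma hyperplane_through_wall_point:
  fixes p :: "'n::{finite,linorder} \<Rightarrow> int"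
  assumes p: "alcove_code p" and n2: "CARD('n) \<ge> 2"
    and "H \<in> hyperplanes" "wall_point p a \<in> H"
  shows "H = wall p a"
proof -
  obtain i j d where H: "H = {x \<in> sum_zero_space. x $ i - x $ j = of_int d}" and ij: "i < j"
    using assms(3) unfolding hyperplanes_def by blast
  have "wall_point p a $ i - wall_point p a $ j = of_int d" using assms(4) H by simp
  moreover have "i \<noteq> j" using ij by simp
  ultimately show ?thesis
    using wall_point_integral_diff[OF p n2] unfolding H wall_def by fastforce
qed

text \<open>A hyperplane that cuts out a facet contains the corresponding \<open>wall_point\<close>,
  and only one hyperplane does.\<close>

lemma walls_cell:
  fixes p :: "'n::{finite,linorder} \<Rightarrow> int"
  assumes p: "alcove_code p" and n2: "CARD('n) \<ge> 2"
  shows "walls (cell p) = range (wall p)"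
proof
  show "walls (cell p) \<subseteq> range (wall p)"
  proof
    fix H assume "H \<in> walls (cell p)"
    then have H: "H \<in> hyperplanes" "(H \<inter> closed_cell p) facet_of closed_cell p"
      by (auto simp: walls_def closure_cell[OF p])
    then obtain a where a: "H \<inter> closed_cell p = closed_cell p \<inter> wall p a"
      using facet_of_closed_cell[OF p n2] by blast
    have "wall_point p a \<in> H"
      using a wall_point_in_wall[OF p n2, of a] wall_point_in_closed_cell[OF p n2, of a] by blast
    then show "H \<in> range (wall p)" using hyperplane_through_wall_point[OF p n2 H(1)] by blast
  qed
  show "range (wall p) \<subseteq> walls (cell p)"
    using wall_in_hyperplanes[OF p n2] facet_of_closed_cell(1)[OF p n2]
    by (auto simp: walls_def closure_cell[OF p] Int_commute)
qed

lemma inj_wall: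
  fixes p :: "'n::{finite,linorder} \<Rightarrow> int"
  assumes p: "alcove_code p" and n2: "CARD('n) \<ge> 2"
  shows "inj (wall p)"
proof (rule injI, rule ccontr)
  fix a c assume eq: "wall p a = wall p c" and ac: "a \<noteq> c"
  let ?m = "wall_point p a"
  have ne: "c \<noteq> next_label p c" using next_label_neq[OF p n2, of c] by simp
  have wc: "?m $ c - ?m $ next_label p c = of_int (level p c (next_label p c)) + 1"
    using wall_point_in_wall[OF p n2, of a] eq by (auto simp: wall_def)
  show False
  proof (cases "c = next_label p a \<and> next_label p c = a")
    case True
    have wa: "?m $ a - ?m $ c = of_int (level p a c) + 1"
      using wall_point_in_wall[OF p n2, of a] True by (auto simp: wall_def)
    have "level p c a = - level p a c - 1" using level_swap[OF p ac] .
    moreover have "?m $ c - ?m $ a = of_int (level p c a) + 1" using wc True by metis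
    ultimately show False using wa by simp
  next
    case False
    then show False using wall_point_strict(2)[OF p n2 ne, of a] wc ac by auto
  qed
qed

text \<open>The closure of the neighbour \<open>q\<close> contains \<open>wall_point p a\<close>,
  where only the difference of \<open>a\<close> and \<open>next_label p a\<close> is an integer. So
  all other levels of \<open>q\<close> agree with those of \<open>p\<close>, and this one either
  agrees too, which gives \<open>q = p\<close>, or is larger by one.\<close>

lemma adjacent_across_wall_iff:
  fixes p :: "'n::{finite,linorder} \<Rightarrow> int"
  assumes p: "alcove_code p" and n2: "CARD('n) \<ge> 2"
  shows "adjacent_across (wall p a) (cell p) B \<longleftrightarrow> B = cell (bump p a)"
proof
  let ?b = "next_label p a" and ?m = "wall_point p a"
  have ab: "a \<noteq> ?b" using next_label_neq[OF p n2, of a] by simp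
  {
    assume adj: "adjacent_across (wall p a) (cell p) B"
    then obtain q where q: "alcove_code q" "B = cell q"
      by (auto simp: adjacent_across_def alcoves_eq)
    have "?m \<in> wall p a \<inter> closure (cell p)"
      using wall_point_in_wall[OF p n2, of a] wall_point_in_closed_cell[OF p n2, of a] closure_cell[OF p] by simp
    then have "?m \<in> closed_cell q"
      using adj closure_cell[OF q(1)] q(2) by (auto simp: adjacent_across_def)
    then have mq: "of_int (level q i j) \<le> ?m $ i - ?m $ j" "?m $ i - ?m $ j \<le> of_int (level q i j) + 1" if "i \<noteq> j" for i j
      using that by (auto simp: closed_cell_def)
    have other: "level q i j = level p i j"
      if "i \<noteq> j" "\<not> (i = a \<and> j = ?b)" "\<not> (i = ?b \<and> j = a)" for i j
      using wall_point_strict[OF p n2 that] mq[OF that(1)] by linarith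
    have "?m $ a - ?m $ ?b = of_int (level p a ?b) + 1"
      using wall_point_in_wall[OF p n2, of a] by (simp add: wall_def)
    then have "level q a ?b = level p a ?b \<or> level q a ?b = level p a ?b + 1"
      using mq[OF ab] by linarith
    moreover have "level q a ?b \<noteq> level p a ?b"
    proof
      assume eq: "level q a ?b = level p a ?b"
      then have "level q ?b a = level p ?b a" using level_swap[OF p ab] level_swap[OF q(1) ab] by simp
      then have "q = p" using eq other by (intro code_eqI q p) blast
      then show False using adj q by (simp add: adjacent_across_def)
    qed
    ultimately have eq: "level q a ?b = level p a ?b + 1" by simp
    then have eq': "level q ?b a = level p ?b a - 1" using level_swap[OF p ab] level_swap[OF q(1) ab] by simp
    have "q = bump p a"
      using eq eq' other by (intro code_eqI q alcove_code_bump p n2) (auto simp: level_bump[OF p n2])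
    then show "B = cell (bump p a)" using q by simp
  }
  assume B: "B = cell (bump p a)"
  have q: "alcove_code (bump p a)" using alcove_code_bump[OF p n2] .
  have lab: "level (bump p a) a ?b = level p a ?b + 1" using level_bump[OF p n2 ab, of a] by simp
  have "cell (bump p a) \<noteq> cell p"
    using cell_inject[OF q p] lab by (metis add_cancel_left_right zero_neq_one)
  moreover have "wall p a = wall (bump p a) ?b"
    unfolding wall_def next_label_bump[OF p n2] using lab level_swap[OF q ab] by auto
  moreover have "wall p a \<inter> closed_cell p = wall p a \<inter> closed_cell (bump p a)"
  proof -
    have "x \<in> closed_cell p \<longleftrightarrow> x \<in> closed_cell (bump p a)" if x: "x \<in> wall p a" for x
    proof -
      have xab: "x $ a - x $ ?b = of_int (level p a ?b) + 1" using x by (simp add: wall_def)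
      have "(of_int (level p i j) \<le> x $ i - x $ j \<and> x $ i - x $ j \<le> of_int (level p i j) + 1) \<longleftrightarrow>
        (of_int (level (bump p a) i j) \<le> x $ i - x $ j \<and> x $ i - x $ j \<le> of_int (level (bump p a) i j) + 1)"
        if "i \<noteq> j" for i j
        using level_bump[OF p n2 that, of a] level_swap[OF p ab] xab by (auto split: if_splits)
      then show ?thesis unfolding closed_cell_def by blast
    qed
    then show ?thesis by blast
  qed
  ultimately show "adjacent_across (wall p a) (cell p) B"
    using B p q walls_cell[OF p n2] walls_cell[OF q n2]
    by (auto simp: adjacent_across_def alcoves_eq closure_cell)
qed

text \<open>Add up the bounds on \<open>y a - y c\<close> over \<open>c\<close>: the differences sum
  to \<open>n y a\<close> because the coordinates sum to zero, and the levels sum to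
  \<open>p a\<close>. Linear functions of places thus agree with those of points up to a bounded
  error.\<close>

lemma closed_cell_place_bounds:
  fixes p :: "'n::{finite,linorder} \<Rightarrow> int"
  assumes p: "alcove_code p" and y: "y \<in> closed_cell p"
  shows "of_int (p a) \<le> real CARD('n) * y $ a" "real CARD('n) * y $ a \<le> of_int (p a) + real CARD('n)"
proof -
  have b: "of_int (level p a c) \<le> y $ a - y $ c" "y $ a - y $ c \<le> of_int (level p a c) + 1" for c
    using y by (cases "a = c", auto simp: closed_cell_def)+
  have s: "(\<Sum>c\<in>UNIV. y $ a - y $ c) = real CARD('n) * y $ a"
    using y by (simp add: sum_subtractf closed_cell_def sum_zero_space_def)
  have pa: "of_int (p a) = (\<Sum>c\<in>UNIV. of_int (level p a c) :: real)"
    using p by (simp add: alcove_code_def flip: of_int_sum)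
  show "of_int (p a) \<le> real CARD('n) * y $ a"
    unfolding pa s[symmetric] by (intro sum_mono b)
  have "(\<Sum>c\<in>UNIV. y $ a - y $ c) \<le> (\<Sum>c\<in>UNIV. of_int (level p a c) + 1)" by (intro sum_mono b)
  then show "real CARD('n) * y $ a \<le> of_int (p a) + real CARD('n)"
    unfolding s by (simp add: sum.distrib pa)
qed

text \<open>The closed cell is a compact convex polyhedron, so it has finitely many extreme points
  and at least one, and contains their average. The bounded error above makes membership all that
  has to be known about the central point.\<close>

lemma central_point_in_closed_cell:
  fixes p :: "'n::{finite,linorder} \<Rightarrow> int"
  assumes p: "alcove_code p" and n2: "CARD('n) \<ge> 2"
  shows "central_point (cell p) \<in> closed_cell p"
proof -
  let ?S = "closed_cell p"
  define E where "E = {v. v extreme_point_of ?S}"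
  have poly: "polyhedron ?S" by (rule facet_of_closed_cell(2)[OF p n2])
  have conv: "convex ?S" using poly by (rule polyhedron_imp_convex)
  have "bounded ?S"
  proof -
    define K where "K = (\<Sum>a\<in>UNIV. \<bar>of_int (p a)\<bar> + real CARD('n))"
    have "norm y \<le> K" if y: "y \<in> ?S" for y
    proof -
      have "\<bar>y $ a\<bar> \<le> \<bar>of_int (p a)\<bar> + real CARD('n)" for a
      proof -
        have "\<bar>y $ a\<bar> \<le> real CARD('n) * \<bar>y $ a\<bar>"
          using mult_right_mono[of 1 "real CARD('n)" "\<bar>y $ a\<bar>"] n2 by simp
        also have "\<dots> = \<bar>real CARD('n) * y $ a\<bar>" by (simp add: abs_mult)
        also have "\<dots> \<le> \<bar>of_int (p a)\<bar> + real CARD('n)"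
          using closed_cell_place_bounds[OF p y, of a] by linarith
        finally show ?thesis .
      qed
      then show ?thesis
        unfolding K_def using norm_le_l1_cart[of y] by (meson order_trans sum_mono)
    qed
    then show ?thesis by (auto simp: bounded_iff)
  qed
  then have comp: "compact ?S" using closed_closed_cell[of p] by (simp add: compact_eq_bounded_closed)
  have ne: "?S \<noteq> {}" using wall_point_in_closed_cell[OF p n2] by blast
  obtain v where "v extreme_point_of ?S" using extreme_point_exists_convex[OF comp conv ne] .
  then have E: "finite E" "E \<noteq> {}" unfolding E_def using finite_polyhedron_extreme_points[OF poly] by auto
  have "central_point (cell p) = (\<Sum>v\<in>E. (1 / real (card E)) *\<^sub>R v)"
    by (simp add: central_point_def closure_cell[OF p] E_def scaleR_sum_right Let_def)
  also have "\<dots> \<in> ?S"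
    using E by (intro convex_sum conv) (auto simp: E_def extreme_point_of_def)
  finally show ?thesis .
qed

section \<open>The fundamental chamber and the fundamental alcove in terms of codes\<close>

lemma cell_in_chamber_iff:
  fixes p :: "'n::{finite,linorder} \<Rightarrow> int"
  assumes p: "alcove_code p"
  shows "cell p \<subseteq> fundamental_chamber \<longleftrightarrow> (\<forall>i j. i < j \<longrightarrow> 0 \<le> level p i j)"
proof
  assume "cell p \<subseteq> fundamental_chamber"
  then have c: "centre p \<in> fundamental_chamber" using centre_in_cell[OF p] by blast
  show "\<forall>i j. i < j \<longrightarrow> 0 \<le> level p i j"
  proof (intro allI impI)
    fix i j :: 'n assume "i < j"
    then have "centre p $ i - centre p $ j > 0" using c by (simp add: fundamental_chamber_def)
    then have "0 \<le> \<lfloor>centre p $ i - centre p $ j\<rfloor>" by simp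
    then show "0 \<le> level p i j" using floor_diff_cell[OF centre_in_cell[OF p]] by simp
  qed
next
  assume nn: "\<forall>i j. i < j \<longrightarrow> 0 \<le> level p i j"
  have "y $ i > y $ j" if "y \<in> cell p" "i < j" for y i j
  proof -
    have "of_int (level p i j) < y $ i - y $ j" using that by (auto simp: cell_def)
    moreover have "0 \<le> (of_int (level p i j) :: real)" using nn that(2) by simp
    ultimately show ?thesis by linarith
  qed
  then show "cell p \<subseteq> fundamental_chamber"
    by (auto simp: fundamental_chamber_def) (simp add: cell_def)
qed

text \<open>In the fundamental alcove the coordinates decrease with the label and span less than 1,
  so their places are consecutive and descending; the normalisation puts the least label at place
  0.\<close>

definition origin_code :: "'n::{finite,linorder} \<Rightarrow> int" where
  "origin_code a = - int (card {..<a})"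

lemma origin_code_diff:
  fixes i j :: "'n::{finite,linorder}"
  assumes "i < j"
  shows "0 < origin_code i - origin_code j" "origin_code i - origin_code j < int CARD('n)"
proof -
  have "card {..<i} < card {..<j}" using assms by (intro psubset_card_mono) auto
  then show "0 < origin_code i - origin_code j" by (simp add: origin_code_def)
  have "card {..<j} < CARD('n)" by (intro psubset_card_mono) auto
  then show "origin_code i - origin_code j < int CARD('n)" by (simp add: origin_code_def)
qed

lemma level_origin_code:
  fixes i j :: "'n::{finite,linorder}"
  shows "level origin_code i j = (if j < i then - 1 else 0)"
proof -
  consider "i < j" | "j < i" | "i = j" by fastforce
  then show ?thesis
  proof cases
    case 1
    then show ?thesis using origin_code_diff[OF 1] by (simp add: level_def)
  next
    case 2
    then have "level origin_code i j = - 1"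
      using origin_code_diff[OF 2] unfolding level_def
      by (intro int_div_pos_eq[where r="int CARD('n) + (origin_code i - origin_code j)"]) auto
    then show ?thesis using 2 by simp
  qed simp
qed

lemma alcove_code_origin: "alcove_code (origin_code :: 'n::{finite,linorder} \<Rightarrow> int)"
  unfolding alcove_code_def
proof (intro conjI allI)
  show "inj (\<lambda>a::'n. origin_code a mod int CARD('n))"
  proof (rule linorder_injI)
    fix i j :: 'n assume ij: "i < j"
    have "\<not> int CARD('n) dvd origin_code i - origin_code j"
      using origin_code_diff[OF ij] zdvd_not_zless by blast
    then show "origin_code i mod int CARD('n) \<noteq> origin_code j mod int CARD('n)"
      by (simp add: mod_eq_dvd_iff)
  qed
  fix a :: 'n
  have "(\<Sum>c\<in>UNIV. level origin_code a c) = (\<Sum>c\<in>{c\<in>UNIV. c < a}. - 1)"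
    by (subst sum.inter_filter) (auto simp: level_origin_code)
  also have "\<dots> = origin_code a" by (simp add: origin_code_def lessThan_def)
  finally show "origin_code a = (\<Sum>c\<in>UNIV. level origin_code a c)" by simp
qed

lemma cell_origin_code:
  "cell origin_code = (fundamental_alcove :: (real ^ 'n::{finite,linorder}) set)"
proof -
  have "y \<in> cell origin_code \<longleftrightarrow> y \<in> fundamental_alcove" for y :: "(real, 'n) vec"
  proof
    assume y: "y \<in> cell origin_code"
    then have b: "0 < y $ i - y $ j \<and> y $ i - y $ j < 1" if "i < j" for i j
    proof -
      have "of_int (level origin_code i j) < y $ i - y $ j" "y $ i - y $ j < of_int (level origin_code i j) + 1"
        using y that by (auto simp: cell_def)
      moreover have "level origin_code i j = 0" using less_not_sym[OF that] by (simp add: level_origin_code)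
      ultimately show ?thesis by simp
    qed
    have mm: "(Min UNIV :: 'n) \<le> Max UNIV" by simp
    have "y $ Max UNIV + 1 > y $ Min UNIV"
    proof (cases "(Min UNIV :: 'n) = Max UNIV")
      case False
      then have "(Min UNIV :: 'n) < Max UNIV" using mm by (rule order.not_eq_order_implies_strict)
      then show ?thesis using b[of "Min UNIV" "Max UNIV"] by simp
    qed simp
    then show "y \<in> fundamental_alcove" using b y by (auto simp: fundamental_alcove_def cell_def)
  next
    assume y: "y \<in> fundamental_alcove"
    then have pos: "y $ j < y $ i" if "i < j" for i j using that by (auto simp: fundamental_alcove_def)
    have le: "y $ j \<le> y $ i" if "i \<le> j" for i j using pos[of i j] that by (cases "i = j") (auto simp: order.strict_iff_order)
    have "y $ i - y $ j < 1" for i j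
      using le[of "Min UNIV" i] le[of j "Max UNIV"] y by (auto simp: fundamental_alcove_def)
    then have b: "y $ i < y $ j + 1" for i j by (simp add: algebra_simps)
    show "y \<in> cell origin_code"
      unfolding cell_def level_origin_code
    proof (intro CollectI conjI allI impI)
      show "y \<in> sum_zero_space" using y by (simp add: fundamental_alcove_def)
      fix a c :: 'n assume "a \<noteq> c"
      then have "a < c \<or> c < a" by auto
      then show "of_int (if c < a then - 1 else 0) < y $ a - y $ c" "y $ a - y $ c < of_int (if c < a then - 1 else 0) + 1"
        using pos[of a c] pos[of c a] b[of a c] b[of c a] by auto
    qed
  qed
  then show ?thesis by blast
qed

section \<open>Dynamics inside the fundamental chamber\<close>

definition chamber_code :: "('n::{finite,linorder} \<Rightarrow> int) \<Rightarrow> bool" where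
  "chamber_code p \<longleftrightarrow> alcove_code p \<and> (\<forall>i j. i < j \<longrightarrow> 0 \<le> level p i j)"

definition inner_moves :: "('n::{finite,linorder} \<Rightarrow> int) \<Rightarrow> 'n set" where
  "inner_moves p = {a. a < next_label p a}"

text \<open>A move \<open>a\<close> with \<open>next_label p a < a\<close> crosses a wall that the walk has already crossed,
  unless it leaves the fundamental chamber.\<close>
definition open_moves :: "('n::{finite,linorder} \<Rightarrow> int) \<Rightarrow> 'n set" where
  "open_moves p = {a. a < next_label p a \<or> level p (next_label p a) a = 0}"

text \<open>Entries after time \<open>t\<close> keep the default value \<open>origin_code\<close>.
  This makes the set finite and lets a history be recovered from its extension by one step.\<close>

primrec histories :: "nat \<Rightarrow> (nat \<Rightarrow> 'n::{finite,linorder} \<Rightarrow> int) set" where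
  "histories 0 = {\<lambda>_. origin_code}"
| "histories (Suc t) = (\<Union>h\<in>histories t. (\<lambda>a. h(Suc t := bump (h t) a)) ` inner_moves (h t))"

definition gap_hyperplane :: "'n \<Rightarrow> 'n \<Rightarrow> int \<Rightarrow> (real ^ 'n::{finite,linorder}) set" where
  "gap_hyperplane i j d = {x \<in> sum_zero_space. x $ i - x $ j = of_int d}"

text \<open>The least label can always jump forward, so a walk inside the chamber never gets
  stuck.\<close>

lemma inner_moves_nonempty:
  fixes p :: "'n::{finite,linorder} \<Rightarrow> int"
  assumes p: "alcove_code p" and n2: "CARD('n) \<ge> 2"
  shows "inner_moves p \<noteq> {}"
proof -
  have "Min UNIV \<noteq> next_label p (Min UNIV)" using next_label_neq[OF p n2, of "Min UNIV"] by simp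
  moreover have "Min UNIV \<le> next_label p (Min UNIV)" by simp
  ultimately have "Min UNIV < next_label p (Min UNIV)" by (rule order.not_eq_order_implies_strict)
  then show ?thesis by (auto simp: inner_moves_def)
qed

lemma inner_moves_subset_open_moves: "inner_moves p \<subseteq> open_moves p"
  by (auto simp: inner_moves_def open_moves_def)

lemma level_bump_inner:
  fixes p :: "'n::{finite,linorder} \<Rightarrow> int"
  assumes p: "alcove_code p" and n2: "CARD('n) \<ge> 2" and a: "a \<in> inner_moves p" and ij: "i < j"
  shows "level (bump p a) i j = level p i j + (if i = a \<and> j = next_label p a then 1 else 0)"
proof -
  have "\<not> (i = next_label p a \<and> j = a)" using a ij less_not_sym by (auto simp: inner_moves_def)
  moreover have "i \<noteq> j" using ij by simp
  ultimately show ?thesis using level_bump[OF p n2, of i j a] by auto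
qed

lemma chamber_code_bump:
  fixes p :: "'n::{finite,linorder} \<Rightarrow> int"
  assumes p: "chamber_code p" and n2: "CARD('n) \<ge> 2" and a: "a \<in> inner_moves p"
  shows "chamber_code (bump p a)"
  using p alcove_code_bump[of p a] level_bump_inner[OF _ n2 a] n2 by (auto simp: chamber_code_def)

lemma bump_leaves_chamber:
  fixes p :: "'n::{finite,linorder} \<Rightarrow> int"
  assumes p: "alcove_code p" and n2: "CARD('n) \<ge> 2" and a: "a \<in> open_moves p - inner_moves p"
  shows "\<not> cell (bump p a) \<subseteq> fundamental_chamber"
proof -
  let ?b = "next_label p a"
  have ne: "?b \<noteq> a" using next_label_neq[OF p n2] .
  then have lt: "?b < a" and l: "level p ?b a = 0" using a by (auto simp: open_moves_def inner_moves_def)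
  have "level (bump p a) ?b a = - 1" using level_bump[OF p n2 ne, of a] l ne by simp
  then show ?thesis
    unfolding cell_in_chamber_iff[OF alcove_code_bump[OF p n2]] using lt by (metis neg_0_le_iff_le not_one_le_zero)
qed

lemma chamber_code_origin: "chamber_code origin_code"
  using alcove_code_origin less_not_sym by (auto simp: chamber_code_def level_origin_code)

lemma bump_inject:
  fixes p :: "'n::finite \<Rightarrow> int"
  assumes p: "alcove_code p" and n2: "CARD('n) \<ge> 2" and eq: "bump p a = bump p c"
  shows "a = c"
proof (rule ccontr)
  assume ac: "a \<noteq> c"
  have "bump p c a = p a + 1" using eq p n2 by (metis bump_same)
  then show False using ac by (auto simp: bump_def split: if_splits)
qed

lemma histories_beyond: "h \<in> histories t \<Longrightarrow> t < j \<Longrightarrow> h j = origin_code"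
  by (induction t arbitrary: h) auto

lemma histories_chamber_code:
  assumes "CARD('n) \<ge> 2" "h \<in> histories t"
  shows "chamber_code (h j :: 'n::{finite,linorder} \<Rightarrow> int)"
  using assms(2)
proof (induction t arbitrary: h j)
  case 0
  then show ?case by (simp add: chamber_code_origin)
next
  case (Suc t)
  from Suc.prems obtain g a where g: "g \<in> histories t" and a: "a \<in> inner_moves (g t)"
    and h: "h = g(Suc t := bump (g t) a)" by auto
  have "chamber_code (g i)" for i using Suc.IH[OF g] .
  then show ?case using h chamber_code_bump[OF _ assms(1) a] by simp
qed

lemma finite_histories: "finite (histories t :: (nat \<Rightarrow> 'n::{finite,linorder} \<Rightarrow> int) set)"
  by (induction t) auto

lemma sum_histories_Suc:
  fixes f :: "(nat \<Rightarrow> 'n::{finite,linorder} \<Rightarrow> int) \<Rightarrow> real"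
  assumes n2: "CARD('n) \<ge> 2"
  shows "(\<Sum>h\<in>histories (Suc t). f h) = (\<Sum>h\<in>histories t. \<Sum>a\<in>inner_moves (h t). f (h(Suc t := bump (h t) a)))"
proof -
  have same: "h = h'" if "h \<in> histories t" "h' \<in> histories t" and eq: "h(Suc t := u) = h'(Suc t := v)"
    for h h' :: "nat \<Rightarrow> 'n \<Rightarrow> int" and u v
  proof
    fix j
    show "h j = h' j"
    proof (cases "j = Suc t")
      case True
      then show ?thesis using histories_beyond that(1,2) by (metis lessI)
    next
      case False
      then show ?thesis using fun_cong[OF eq, of j] by simp
    qed
  qed
  have "(\<Sum>h\<in>histories (Suc t). f h)
      = (\<Sum>h\<in>histories t. \<Sum>h'\<in>(\<lambda>a. h(Suc t := bump (h t) a)) ` inner_moves (h t). f h')"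
    unfolding histories.simps
    by (rule sum.UNION_disjoint) (auto simp: finite_histories dest: same)
  also have "\<dots> = (\<Sum>h\<in>histories t. \<Sum>a\<in>inner_moves (h t). f (h(Suc t := bump (h t) a)))"
  proof (rule sum.cong[OF refl])
    fix h :: "nat \<Rightarrow> 'n \<Rightarrow> int" assume h: "h \<in> histories t"
    have "inj_on (\<lambda>a. h(Suc t := bump (h t) a)) (inner_moves (h t))"
    proof (rule inj_onI)
      fix a c assume "h(Suc t := bump (h t) a) = h(Suc t := bump (h t) c)"
      then have "bump (h t) a = bump (h t) c" by (metis fun_upd_same)
      then show "a = c" using bump_inject n2 histories_chamber_code[OF n2 h] unfolding chamber_code_def by blast
    qed
    then show "(\<Sum>h'\<in>(\<lambda>a. h(Suc t := bump (h t) a)) ` inner_moves (h t). f h')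
        = (\<Sum>a\<in>inner_moves (h t). f (h(Suc t := bump (h t) a)))"
      by (simp add: sum.reindex)
  qed
  finally show ?thesis .
qed

section \<open>Crossed and uncrossed walls along a history\<close>

lemma wall_eq_gap_hyperplane:
  fixes p :: "'n::{finite,linorder} \<Rightarrow> int"
  assumes p: "alcove_code p" and n2: "CARD('n) \<ge> 2"
  shows "wall p a = gap_hyperplane a (next_label p a) (level p a (next_label p a) + 1)"
    "wall p a = gap_hyperplane (next_label p a) a (level p (next_label p a) a)"
  using level_swap[OF p next_label_neq[OF p n2, of a, symmetric]]
  by (auto simp: wall_def gap_hyperplane_def)

lemma adjacent_across_bump_iff:
  fixes p :: "'n::{finite,linorder} \<Rightarrow> int"
  assumes p: "alcove_code p" and n2: "CARD('n) \<ge> 2"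
  shows "adjacent_across H (cell p) (cell (bump p a)) \<longleftrightarrow> H = wall p a"
proof
  assume adj: "adjacent_across H (cell p) (cell (bump p a))"
  then have "H \<in> range (wall p)" using walls_cell[OF p n2] by (auto simp: adjacent_across_def)
  then obtain c where c: "H = wall p c" by blast
  then have "cell (bump p a) = cell (bump p c)" using adj adjacent_across_wall_iff[OF p n2] by blast
  then have "bump p a = bump p c" by (intro cell_inject alcove_code_bump p n2)
  then show "H = wall p a" using bump_inject[OF p n2] c by blast
next
  assume "H = wall p a"
  then show "adjacent_across H (cell p) (cell (bump p a))" using adjacent_across_wall_iff[OF p n2] by blast
qed

text \<open>The crossed walls are exactly the hyperplanes between the current alcove and the
  fundamental one, whatever the path: an inner move raises one level and adds the hyperplane at the
  new value. Hence the permitted moves depend on the current alcove only.\<close>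

lemma crossed_walls:
  fixes h :: "nat \<Rightarrow> 'n::{finite,linorder} \<Rightarrow> int"
  assumes n2: "CARD('n) \<ge> 2" and h: "h \<in> histories t"
  shows "{H. \<exists>j<t. adjacent_across H (cell (h j)) (cell (h (Suc j)))}
    = {gap_hyperplane i j d | i j d. i < j \<and> 1 \<le> d \<and> d \<le> level (h t) i j}"
  using h
proof (induction t arbitrary: h)
  case 0
  then show ?case using less_not_sym by (auto simp: level_origin_code)
next
  case (Suc t)
  from Suc.prems obtain g a where g: "g \<in> histories t" and a: "a \<in> inner_moves (g t)"
    and h: "h = g(Suc t := bump (g t) a)" by auto
  let ?b = "next_label (g t) a"
  have code: "alcove_code (g t)" using histories_chamber_code[OF n2 g] by (simp add: chamber_code_def)
  have ab: "a < ?b" using a by (simp add: inner_moves_def)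
  have lev: "level (h (Suc t)) i j = level (g t) i j + (if i = a \<and> j = ?b then 1 else 0)" if "i < j" for i j
    using level_bump_inner[OF code n2 a that] h by simp
  have nn: "0 \<le> level (g t) a ?b" using histories_chamber_code[OF n2 g, of t] ab by (simp add: chamber_code_def)
  have hj: "h j = g j" if "j \<le> t" for j using h that by simp
  have hS: "h (Suc t) = bump (g t) a" using h by simp
  have "(\<exists>j<Suc t. adjacent_across H (cell (h j)) (cell (h (Suc j)))) \<longleftrightarrow>
      (\<exists>j<t. adjacent_across H (cell (g j)) (cell (g (Suc j)))) \<or> adjacent_across H (cell (g t)) (cell (bump (g t) a))" for H
    unfolding less_Suc_eq using hj hS by (metis Suc_leI less_imp_le order_refl)
  then have "{H. \<exists>j<Suc t. adjacent_across H (cell (h j)) (cell (h (Suc j)))}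
      = {H. \<exists>j<t. adjacent_across H (cell (g j)) (cell (g (Suc j)))}
        \<union> {H. adjacent_across H (cell (g t)) (cell (bump (g t) a))}"
    by blast
  also have "\<dots> = {gap_hyperplane i j d | i j d. i < j \<and> 1 \<le> d \<and> d \<le> level (g t) i j}
      \<union> {gap_hyperplane a ?b (level (g t) a ?b + 1)}"
    using Suc.IH[OF g] adjacent_across_bump_iff[OF code n2] wall_eq_gap_hyperplane(1)[OF code n2, of a] by simp
  also have "\<dots> = {gap_hyperplane i j d | i j d. i < j \<and> 1 \<le> d \<and> d \<le> level (h (Suc t)) i j}" (is "?L = ?R")
  proof
    show "?L \<subseteq> ?R"
    proof
      fix H assume "H \<in> ?L"
      then consider i j d where "H = gap_hyperplane i j d" "i < j" "1 \<le> d" "d \<le> level (g t) i j"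
        | "H = gap_hyperplane a ?b (level (g t) a ?b + 1)" by blast
      then show "H \<in> ?R"
      proof cases
        case 1
        have "level (g t) i j \<le> level (h (Suc t)) i j" using lev[OF 1(2)] by simp
        then have "d \<le> level (h (Suc t)) i j" using 1(4) by (rule order_trans[rotated])
        then show ?thesis using 1 by blast
      next
        case 2
        have "level (g t) a ?b + 1 \<le> level (h (Suc t)) a ?b" "1 \<le> level (g t) a ?b + 1" using lev[OF ab] nn by simp_all
        then show ?thesis using 2 ab by blast
      qed
    qed
    show "?R \<subseteq> ?L"
    proof
      fix H assume "H \<in> ?R"
      then obtain i j d where H: "H = gap_hyperplane i j d" "i < j" "1 \<le> d" "d \<le> level (h (Suc t)) i j" by blast
      show "H \<in> ?L"
      proof (cases "d \<le> level (g t) i j")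
        case True
        then show ?thesis using H by blast
      next
        case False
        then have "i = a \<and> j = ?b \<and> d = level (g t) a ?b + 1" using H(4) lev[OF H(2)] by (auto split: if_splits)
        then show ?thesis using H(1) by blast
      qed
    qed
  qed
  finally show ?case .
qed

text \<open>With \<open>b = next_label p a\<close>, the wall \<open>a\<close> is also the lower
  bound \<open>level p b a\<close> of \<open>x b - x a\<close>. It has been crossed iff
  \<open>b < a\<close> and this bound is at least 1; the bound 0 belongs to a wall of the chamber
  itself.\<close>

lemma uncrossed_walls_history:
  fixes h :: "nat \<Rightarrow> 'n::{finite,linorder} \<Rightarrow> int"
  assumes n2: "CARD('n) \<ge> 2" and h: "h \<in> histories t"
  shows "uncrossed_walls (\<lambda>j. cell (h j)) t = wall (h t) ` open_moves (h t)"
proof -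
  let ?p = "h t"
  have code: "alcove_code ?p" and nn: "i < j \<Longrightarrow> 0 \<le> level ?p i j" for i j
    using histories_chamber_code[OF n2 h, of t] by (auto simp: chamber_code_def)
  have "wall ?p a \<in> {gap_hyperplane i j d | i j d. i < j \<and> 1 \<le> d \<and> d \<le> level ?p i j} \<longleftrightarrow> a \<notin> open_moves ?p" for a
  proof
    let ?b = "next_label ?p a"
    assume "wall ?p a \<in> {gap_hyperplane i j d | i j d. i < j \<and> 1 \<le> d \<and> d \<le> level ?p i j}"
    then obtain i j d where H: "wall ?p a = gap_hyperplane i j d" "i < j" "1 \<le> d" "d \<le> level ?p i j" by blast
    have "wall_point ?p a \<in> gap_hyperplane i j d" using wall_point_in_wall[OF code n2] H(1) by blast
    then have "wall_point ?p a $ i - wall_point ?p a $ j = of_int d" by (simp add: gap_hyperplane_def)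
    moreover have "i \<noteq> j" using H(2) by simp
    ultimately have "i = a \<and> j = ?b \<and> d = level ?p a ?b + 1 \<or> i = ?b \<and> j = a"
      using wall_point_integral_diff[OF code n2] by blast
    then have "i = ?b \<and> j = a" using H(4) by auto
    then show "a \<notin> open_moves ?p" using H less_not_sym by (auto simp: open_moves_def)
  next
    let ?b = "next_label ?p a"
    assume a: "a \<notin> open_moves ?p"
    then have "\<not> a < ?b" "level ?p ?b a \<noteq> 0" by (simp_all add: open_moves_def)
    then have "?b < a" using next_label_neq[OF code n2, of a] by auto
    moreover have "1 \<le> level ?p ?b a" using nn[OF \<open>?b < a\<close>] \<open>level ?p ?b a \<noteq> 0\<close> by simp
    ultimately show "wall ?p a \<in> {gap_hyperplane i j d | i j d. i < j \<and> 1 \<le> d \<and> d \<le> level ?p i j}"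
      using wall_eq_gap_hyperplane(2)[OF code n2, of a] by blast
  qed
  note open_iff = this
  have "uncrossed_walls (\<lambda>j. cell (h j)) t = walls (cell ?p) - {H. \<exists>j<t. adjacent_across H (cell (h j)) (cell (h (Suc j)))}"
    by (auto simp: uncrossed_walls_def)
  also have "\<dots> = range (wall ?p) - {gap_hyperplane i j d | i j d. i < j \<and> 1 \<le> d \<and> d \<le> level ?p i j}"
    unfolding crossed_walls[OF n2 h] walls_cell[OF code n2] ..
  also have "\<dots> = wall ?p ` open_moves ?p" using open_iff by blast
  finally show ?thesis .
qed

lemma step_probability:
  fixes h :: "nat \<Rightarrow> 'n::{finite,linorder} \<Rightarrow> int"
  assumes n2: "CARD('n) \<ge> 2" and h: "h \<in> histories t" and a: "a \<in> open_moves (h t)"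
  shows "measure_pmf.prob (pmf_of_set (uncrossed_walls (\<lambda>j. cell (h j)) t))
      {H. adjacent_across H (cell (h t)) (cell (bump (h t) a))} = 1 / real (card (open_moves (h t)))"
proof -
  let ?p = "h t" and ?U = "wall (h t) ` open_moves (h t)"
  have code: "alcove_code ?p" using histories_chamber_code[OF n2 h, of t] by (simp add: chamber_code_def)
  have U: "finite ?U" "?U \<noteq> {}" using a by auto
  have "{H. adjacent_across H (cell ?p) (cell (bump ?p a))} = {wall ?p a}"
    using adjacent_across_bump_iff[OF code n2] by auto
  then have "measure_pmf.prob (pmf_of_set ?U) {H. adjacent_across H (cell ?p) (cell (bump ?p a))} = pmf (pmf_of_set ?U) (wall ?p a)"
    by (simp add: measure_pmf_single)
  also have "\<dots> = 1 / real (card ?U)" using U a by simp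
  also have "card ?U = card (open_moves ?p)"
    using inj_wall[OF code n2] by (simp add: card_image inj_on_subset)
  finally show ?thesis unfolding uncrossed_walls_history[OF n2 h] .
qed

lemma total_level_history:
  fixes h :: "nat \<Rightarrow> 'n::{finite,linorder} \<Rightarrow> int"
  assumes n2: "CARD('n) \<ge> 2" and h: "h \<in> histories t"
  shows "(\<Sum>(i,j)\<in>{(i,j). i < j}. level (h t) i j) = int t"
  using h
proof (induction t arbitrary: h)
  case 0
  have "(\<Sum>(i,j)\<in>{(i::'n,j). i < j}. level origin_code i j) = 0"
    using less_not_sym by (intro sum.neutral) (auto simp: level_origin_code)
  then show ?case using 0 by simp
next
  case (Suc t)
  from Suc.prems obtain g a where g: "g \<in> histories t" and a: "a \<in> inner_moves (g t)"
    and h: "h = g(Suc t := bump (g t) a)" by auto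
  have code: "alcove_code (g t)" using histories_chamber_code[OF n2 g] by (simp add: chamber_code_def)
  have "(\<Sum>(i,j)\<in>{(i,j). i < j}. level (bump (g t) a) i j)
      = (\<Sum>q\<in>{(i,j). i < j}. (case q of (i,j) \<Rightarrow> level (g t) i j) + (if q = (a, next_label (g t) a) then 1 else 0))"
    using level_bump_inner[OF code n2 a] by (intro sum.cong) (auto split: if_splits)
  also have "\<dots> = int t + 1"
    using Suc.IH[OF g] a by (simp add: sum.distrib inner_moves_def)
  finally show ?case using h by simp
qed

text \<open>Every step raises one level by one, so \<open>t\<close> is a sum of at most
  \<open>n^2\<close> levels, each bounded by a coordinate difference and hence by
  \<open>2 * norm y\<close>.\<close>

lemma norm_lower_bound:
  fixes h :: "nat \<Rightarrow> 'n::{finite,linorder} \<Rightarrow> int"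
  assumes n2: "CARD('n) \<ge> 2" and h: "h \<in> histories t" and y: "y \<in> closed_cell (h t)"
  shows "real t \<le> 2 * (real CARD('n))\<^sup>2 * norm y"
proof -
  have "real t = (\<Sum>(i,j)\<in>{(i,j). i < j}. of_int (level (h t) i j))"
    using arg_cong[OF total_level_history[OF n2 h], of real_of_int] by (simp add: case_prod_unfold)
  also have "\<dots> \<le> (\<Sum>q\<in>{(i::'n,j). i < j}. 2 * norm y)"
  proof (intro sum_mono, clarify)
    fix i j :: 'n assume "i < j"
    then have "of_int (level (h t) i j) \<le> y $ i - y $ j" using y by (auto simp: closed_cell_def)
    also have "\<dots> \<le> 2 * norm y"
      using component_le_norm_cart[of y i] component_le_norm_cart[of y j] by linarith
    finally show "of_int (level (h t) i j) \<le> 2 * norm y" .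
  qed
  also have "\<dots> = 2 * (real (card {(i::'n,j). i < j}) * norm y)" by simp
  also have "\<dots> \<le> 2 * ((real CARD('n))\<^sup>2 * norm y)"
  proof -
    have "card {(i::'n,j). i < j} \<le> card (UNIV :: ('n \<times> 'n) set)" by (intro card_mono) auto
    then have "real (card {(i::'n,j). i < j}) \<le> real (CARD('n) * CARD('n))" unfolding of_nat_le_iff by simp
    then show ?thesis by (intro mult_left_mono mult_right_mono) (simp_all add: power2_eq_square)
  qed
  finally show ?thesis by simp
qed

section \<open>The ring of sites and the compensated current\<close>

lemma ring_sites_next_label:
  fixes q :: "'n::finite \<Rightarrow> int"
  assumes q: "alcove_code q" and n2: "CARD('n) \<ge> 2"
  shows "ring_sites (next_label q)"
proof
  let ?n = "int CARD('n)"
  have nx: "?n dvd q (next_label q a) - q a - 1" for a using next_label_iff[OF q] by blast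
  have "inj (next_label q)"
  proof (rule injI)
    fix a c assume "next_label q a = next_label q c"
    then have "?n dvd q (next_label q a) - q c - 1" using nx[of c] by metis
    with nx have "?n dvd (q (next_label q a) - q a - 1) - (q (next_label q a) - q c - 1)" by (rule dvd_diff)
    also have "(q (next_label q a) - q a - 1) - (q (next_label q a) - q c - 1) = q c - q a" by simp
    finally show "a = c" unfolding mod_eq_iff_code[OF q] by (rule sym)
  qed
  then show "bij (next_label q)" using finite_UNIV_inj_surj[of "next_label q"] by (simp add: bij_def)
  have orbit: "?n dvd q ((next_label q ^^ i) s) - q s - int i" for i s
  proof (induction i)
    case (Suc i)
    have "?n dvd (q (next_label q ((next_label q ^^ i) s)) - q ((next_label q ^^ i) s) - 1) + (q ((next_label q ^^ i) s) - q s - int i)"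
      using nx Suc by (rule dvd_add)
    then show ?case by (simp add: algebra_simps)
  qed simp
  fix s t
  define i where "i = nat ((q t - q s) mod ?n)"
  have "int i = (q t - q s) mod ?n" by (simp add: i_def)
  then have "?n dvd q t - q s - int i" by (simp add: minus_mod_eq_mult_div)
  then have "?n dvd (q ((next_label q ^^ i) s) - q s - int i) - (q t - q s - int i)"
    using orbit by (rule dvd_diff[rotated])
  also have "(q ((next_label q ^^ i) s) - q s - int i) - (q t - q s - int i) = q ((next_label q ^^ i) s) - q t" by simp
  finally have "(next_label q ^^ i) s = t" unfolding mod_eq_iff_code[OF q] .
  then show "\<exists>i. (next_label q ^^ i) s = t" ..
qed (rule n2)

text \<open>The sites of the ring are named by the labels which occupy them in the fundamental alcove.\<close>
definition site :: "int \<Rightarrow> 'n::{finite,linorder}" where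
  "site z = (THE s. int CARD('n) dvd origin_code s - z)"

abbreviation ring_shift :: "'n::{finite,linorder} \<Rightarrow> 'n" where
  "ring_shift \<equiv> next_label origin_code"

lemma site_iff: "site z = (s :: 'n::{finite,linorder}) \<longleftrightarrow> int CARD('n) dvd origin_code s - z"
proof -
  let ?n = "int CARD('n)"
  obtain s0 :: 'n where s0: "?n dvd origin_code s0 - z"
    using code_occupies_residue[OF alcove_code_origin] by blast
  have uniq: "s = s0" if "?n dvd origin_code s - z" for s :: 'n
  proof -
    have "?n dvd (origin_code s - z) - (origin_code s0 - z)" using that s0 by (rule dvd_diff)
    also have "(origin_code s - z) - (origin_code s0 - z) = origin_code s - origin_code s0" by simp
    finally show ?thesis using mod_eq_iff_code[OF alcove_code_origin] by blast
  qed
  have "site z = s0" unfolding site_def using s0 uniq by (rule the_equality)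
  then show ?thesis using s0 uniq by blast
qed

lemma site_eq_iff: "(site z :: 'n::{finite,linorder}) = site w \<longleftrightarrow> int CARD('n) dvd z - w"
proof -
  let ?s = "site w :: 'n"
  have "int CARD('n) dvd origin_code ?s - w" using site_iff by blast
  moreover have "origin_code ?s - z = (origin_code ?s - w) - (z - w)" by simp
  ultimately have "int CARD('n) dvd origin_code ?s - z \<longleftrightarrow> int CARD('n) dvd z - w"
    by (metis dvd_diff_right_iff)
  then show ?thesis using site_iff by metis
qed

lemma ring_shift_site: "ring_shift (site z :: 'n::{finite,linorder}) = site (z + 1)"
proof -
  let ?s = "site z :: 'n"
  have "int CARD('n) dvd (origin_code (ring_shift ?s) - origin_code ?s - 1) + (origin_code ?s - z)"
    using next_label_iff[OF alcove_code_origin] site_iff by (intro dvd_add) blast+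
  then have "int CARD('n) dvd origin_code (ring_shift ?s) - (z + 1)" by (simp add: algebra_simps)
  then show ?thesis using site_iff by metis
qed

definition occupied :: "('n::{finite,linorder} \<Rightarrow> int) \<Rightarrow> 'n \<Rightarrow> 'n set" where
  "occupied p k = (\<lambda>a. site (p a)) ` {..k}"

lemma inj_site_code:
  assumes "alcove_code (p :: 'n::{finite,linorder} \<Rightarrow> int)"
  shows "(site (p a) :: 'n) = site (p c) \<longleftrightarrow> a = c"
  using mod_eq_iff_code[OF assms] by (simp add: site_eq_iff)

lemma ring_shift_code:
  assumes "alcove_code (p :: 'n::{finite,linorder} \<Rightarrow> int)"
  shows "ring_shift (site (p a) :: 'n) = site (p (next_label p a))"
proof -
  have "int CARD('n) dvd p (next_label p a) - p a - 1" using next_label_iff[OF assms] by blast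
  then have "int CARD('n) dvd p (next_label p a) - (p a + 1)" by (simp add: algebra_simps)
  then show ?thesis unfolding ring_shift_site using site_eq_iff by metis
qed

text \<open>The configuration of the labels \<open>\<le> k\<close> sees an exchange only if it
  involves a label on each side of the threshold.\<close>

lemma occupied_bump:
  fixes p :: "'n::{finite,linorder} \<Rightarrow> int"
  assumes p: "alcove_code p" and n2: "CARD('n) \<ge> 2"
  shows "a \<le> k \<Longrightarrow> \<not> next_label p a \<le> k \<Longrightarrow> occupied (bump p a) k = hop ring_shift (site (p a)) (occupied p k)"
    and "a \<le> k \<longleftrightarrow> next_label p a \<le> k \<Longrightarrow> occupied (bump p a) k = occupied p k"
proof -
  let ?b = "next_label p a" and ?\<tau> = "Transposition.transpose a (next_label p a)"
  let ?f = "\<lambda>x. site (p x) :: 'n"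
  have "site (bump p a x) = ?f (?\<tau> x)" for x
    unfolding site_eq_iff by (rule bump_residue[OF p n2])
  then have occ: "occupied (bump p a) k = ?f ` ?\<tau> ` {..k}"
    by (simp add: occupied_def image_comp comp_def)
  {
    assume "a \<le> k" "\<not> ?b \<le> k"
    then have "?\<tau> ` {..k} = insert ?b ({..k} - {a})"
      by (force simp: Transposition.transpose_def image_iff)
    then have "occupied (bump p a) k = insert (?f ?b) (?f ` ({..k} - {a}))" using occ by simp
    also have "\<dots> = insert (?f ?b) (?f ` {..k} - {?f a})" using inj_site_code[OF p] by auto
    finally show "occupied (bump p a) k = hop ring_shift (site (p a)) (occupied p k)"
      unfolding hop_def ring_shift_code[OF p] by (simp add: occupied_def)
  }
  assume "a \<le> k \<longleftrightarrow> ?b \<le> k"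
  then have "?\<tau> ` {..k} = {..k}" by (simp add: transpose_image_eq)
  then show "occupied (bump p a) k = occupied p k" using occ by (simp add: occupied_def)
qed

lemma hop_sites_occupied:
  fixes p :: "'n::{finite,linorder} \<Rightarrow> int"
  assumes p: "alcove_code p"
  shows "hop_sites ring_shift (occupied p k) = (\<lambda>a. site (p a)) ` {a. a \<le> k \<and> \<not> next_label p a \<le> k}"
  unfolding hop_sites_def occupied_def using inj_site_code[OF p] ring_shift_code[OF p] by auto

lemma card_occupied:
  fixes p :: "'n::{finite,linorder} \<Rightarrow> int"
  assumes p: "alcove_code p"
  shows "card (occupied p k) = card {..k}"
  unfolding occupied_def using inj_site_code[OF p] by (intro card_image inj_onI) blast

text \<open>The increments of \<open>\<Sum>a\<le>k. p a\<close> over the inner moves add up to the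
  number of possible hops, which varies with the alcove. Subtracting the Poisson solution of the
  configuration replaces this number by its mean; the correction is bounded because there are
  finitely many configurations.\<close>

lemma compensated_current:
  fixes k :: "'n::{finite,linorder}"
  assumes n2: "CARD('n) \<ge> 2" and k: "card {..k} < CARD('n)"
  obtains \<Psi> :: "('n \<Rightarrow> int) \<Rightarrow> real" and K where
    "\<And>p. alcove_code p \<Longrightarrow> (\<Sum>a\<in>inner_moves p. \<Psi> (bump p a) - \<Psi> p) = mean_current (CARD('n)) (card {..k})"
    "\<And>p a. alcove_code p \<Longrightarrow> a \<in> inner_moves p \<Longrightarrow> \<bar>\<Psi> (bump p a) - \<Psi> p\<bar> \<le> K"
    "\<And>p. \<bar>\<Psi> p - of_int (\<Sum>a\<le>k. p a)\<bar> \<le> K"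
proof -
  interpret ring_sites "ring_shift :: 'n \<Rightarrow> 'n" by (rule ring_sites_next_label[OF alcove_code_origin n2])
  let ?c = "mean_current (CARD('n)) (card {..k})"
  have k1: "1 \<le> card {..k}" by (metis One_nat_def Suc_leI atMost_iff card_gt_0_iff empty_iff finite order_refl)
  obtain f where f: "\<And>\<eta>. card \<eta> = card {..k} \<Longrightarrow> generator f \<eta> = real (card (hop_sites ring_shift \<eta>)) - ?c"
    using poisson_equation[OF k1 k] by blast
  define B where "B = (\<Sum>\<eta>\<in>UNIV. \<bar>f \<eta>\<bar>)"
  have B: "\<bar>f \<eta>\<bar> \<le> B" for \<eta> unfolding B_def by (rule member_le_sum) auto
  define \<Psi> where "\<Psi> p = of_int (\<Sum>a\<le>k. p a) - f (occupied p k)" for p :: "'n \<Rightarrow> int"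
  have current: "(\<Sum>x\<le>k. bump p a x) = (\<Sum>x\<le>k. p x) + (if a \<le> k \<and> \<not> next_label p a \<le> k then 1 else 0)"
    if p: "alcove_code p" and a: "a \<in> inner_moves p" for p :: "'n \<Rightarrow> int" and a
  proof -
    have ab: "next_label p a \<noteq> a" using next_label_neq[OF p n2] .
    have "bump p a x = p x + (if x = a then 1 else 0) + (if x = next_label p a then - 1 else 0)" for x
      using ab by (auto simp: bump_def)
    then have "(\<Sum>x\<le>k. bump p a x) = (\<Sum>x\<le>k. p x) + (if a \<le> k then 1 else 0) + (if next_label p a \<le> k then - 1 else 0)"
      by (simp add: sum.distrib)
    \<comment> \<open>Inner moves carry the smaller label forward, so no label
      \<open>\<le> k\<close> is ever pushed back by a larger label outside the threshold: the
      current has no negative part.\<close>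
    moreover have "a \<le> k" if "next_label p a \<le> k" using that a by (auto simp: inner_moves_def)
    ultimately show ?thesis by auto
  qed
  have step: "\<Psi> (bump p a) - \<Psi> p = (if a \<le> k \<and> \<not> next_label p a \<le> k
      then 1 - (f (hop ring_shift (site (p a)) (occupied p k)) - f (occupied p k)) else 0)"
    if p: "alcove_code p" and a: "a \<in> inner_moves p" for p :: "'n \<Rightarrow> int" and a
  proof -
    have "next_label p a \<le> k \<longrightarrow> a \<le> k" using a by (auto simp: inner_moves_def)
    then consider "a \<le> k" "\<not> next_label p a \<le> k" | "a \<le> k \<longleftrightarrow> next_label p a \<le> k" by blast
    then show ?thesis
    proof cases
      case 1
      then show ?thesis unfolding \<Psi>_def current[OF p a] occupied_bump(1)[OF p n2 1] by simp
    next
      case 2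
      then show ?thesis unfolding \<Psi>_def current[OF p a] occupied_bump(2)[OF p n2 2] by simp
    qed
  qed
  show thesis
  proof (rule that)
    fix p :: "'n \<Rightarrow> int" assume p: "alcove_code p"
    let ?S = "{a. a \<le> k \<and> \<not> next_label p a \<le> k}" and ?\<eta> = "occupied p k"
    have sub: "?S \<subseteq> inner_moves p" by (auto simp: inner_moves_def)
    have inj: "inj_on (\<lambda>a. site (p a) :: 'n) ?S" using inj_site_code[OF p] by (auto simp: inj_on_def)
    have "(\<Sum>a\<in>inner_moves p. \<Psi> (bump p a) - \<Psi> p)
        = (\<Sum>a\<in>?S. 1 - (f (hop ring_shift (site (p a)) ?\<eta>) - f ?\<eta>))"
      using sub by (intro sum.mono_neutral_cong_right) (auto simp: step[OF p] subset_iff)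
    also have "\<dots> = (\<Sum>s\<in>hop_sites ring_shift ?\<eta>. 1 - (f (hop ring_shift s ?\<eta>) - f ?\<eta>))"
      unfolding hop_sites_occupied[OF p] by (subst sum.reindex[OF inj]) simp
    also have "\<dots> = real (card (hop_sites ring_shift ?\<eta>)) - generator f ?\<eta>"
      by (simp add: generator_def sum_subtractf)
    also have "\<dots> = ?c" using f[OF card_occupied[OF p]] by simp
    finally show "(\<Sum>a\<in>inner_moves p. \<Psi> (bump p a) - \<Psi> p) = ?c" .
  next
    fix p :: "'n \<Rightarrow> int" and a assume "alcove_code p" "a \<in> inner_moves p"
    \<comment> \<open>A move changes the sum of places by at most 1 and \<open>f\<close> by at most
      \<open>2 * B\<close>.\<close>
    then show "\<bar>\<Psi> (bump p a) - \<Psi> p\<bar> \<le> 1 + 2 * B"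
      using step[of p a] B[of "hop ring_shift (site (p a)) (occupied p k)"] B[of "occupied p k"] by auto
  next
    fix p :: "'n \<Rightarrow> int"
    have "0 \<le> B" unfolding B_def by (intro sum_nonneg) simp
    then show "\<bar>\<Psi> p - of_int (\<Sum>a\<le>k. p a)\<bar> \<le> 1 + 2 * B" using B[of "occupied p k"] by (simp add: \<Psi>_def)
  qed
qed

section \<open>The random walk\<close>

definition path_event :: "'w measure \<Rightarrow> (nat \<Rightarrow> 'w \<Rightarrow> (real ^ 'n::{finite,linorder}) set) \<Rightarrow> nat \<Rightarrow> (nat \<Rightarrow> 'n \<Rightarrow> int) \<Rightarrow> 'w set" where
  "path_event M X t h = {\<omega> \<in> space M. \<forall>j\<le>t. X j \<omega> = cell (h j)}"

locale reduced_walk =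
  fixes M :: "'w measure" and X :: "nat \<Rightarrow> 'w \<Rightarrow> (real ^ 'n::{finite,linorder}) set"
  assumes walk: "reduced_random_walk M X" and n2: "CARD('n) \<ge> 2"
begin

sublocale prob_space M
  using walk by (simp add: reduced_random_walk_def)

lemma history_code: "h \<in> histories t \<Longrightarrow> alcove_code (h j :: 'n \<Rightarrow> int)"
  using histories_chamber_code[OF n2] by (auto simp: chamber_code_def)

lemma path_event_sets: 
  assumes "h \<in> histories t"
  shows "path_event M X s h \<in> sets M"
proof -
  have "{\<omega> \<in> space M. X j \<omega> = cell (h j)} \<in> sets M" for j
  proof -
    have "X j \<in> measurable M (count_space alcoves)" using walk by (simp add: reduced_random_walk_def)
    moreover have "cell (h j) \<in> alcoves" using history_code[OF assms] by (auto simp: alcoves_eq)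
    ultimately have "X j -` {cell (h j)} \<inter> space M \<in> sets M" by (intro measurable_sets[of _ M "count_space alcoves"]) auto
    moreover have "X j -` {cell (h j)} \<inter> space M = {\<omega> \<in> space M. X j \<omega> = cell (h j)}" by auto
    ultimately show ?thesis by simp
  qed
  then have "(\<Inter>j\<in>{..s}. {\<omega> \<in> space M. X j \<omega> = cell (h j)}) \<in> sets M" by (intro sets.finite_INT) auto
  moreover have "(\<Inter>j\<in>{..s}. {\<omega> \<in> space M. X j \<omega> = cell (h j)}) = path_event M X s h"
    by (auto simp: path_event_def)
  ultimately show ?thesis by simp
qed

lemma path_event_Suc:
  "path_event M X (Suc t) (h(Suc t := q)) = {\<omega> \<in> path_event M X t h. X (Suc t) \<omega> = cell q}"
proof -
  have "(h(Suc t := q)) j = h j" if "j \<le> t" for j using that by simp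
  then have "(\<forall>j\<le>t. X j \<omega> = cell ((h(Suc t := q)) j)) \<longleftrightarrow> (\<forall>j\<le>t. X j \<omega> = cell (h j))" for \<omega> by metis
  moreover have "(\<forall>j\<le>Suc t. P j) \<longleftrightarrow> (\<forall>j\<le>t. P j) \<and> P (Suc t)" for P by (metis le_Suc_eq)
  ultimately show ?thesis unfolding path_event_def by (simp add: conj_assoc)
qed

lemma prob_path_event_Suc:
  assumes h: "h \<in> histories t" and a: "a \<in> open_moves (h t)"
  shows "prob (path_event M X (Suc t) (h(Suc t := bump (h t) a))) = prob (path_event M X t h) / real (card (open_moves (h t)))"
proof (cases "prob (path_event M X t h) > 0")
  case True
  have "\<P>(\<omega> in M. X (Suc t) \<omega> = cell (bump (h t) a) \<bar> \<forall>j\<le>t. X j \<omega> = cell (h j)) = 1 / real (card (open_moves (h t)))"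
  proof -
    have "\<P>(\<omega> in M. \<forall>j\<le>t. X j \<omega> = cell (h j)) > 0" using True by (simp only: path_event_def)
    moreover have "\<P>(\<omega> in M. \<forall>j\<le>i. X j \<omega> = A j) > 0 \<longrightarrow>
        \<P>(\<omega> in M. X (Suc i) \<omega> = B \<bar> \<forall>j\<le>i. X j \<omega> = A j) =
        measure_pmf.prob (pmf_of_set (uncrossed_walls A i)) {H. adjacent_across H (A i) B}" for i A B
      using walk unfolding reduced_random_walk_def by blast
    ultimately have "\<P>(\<omega> in M. X (Suc t) \<omega> = cell (bump (h t) a) \<bar> \<forall>j\<le>t. X j \<omega> = cell (h j)) =
        measure_pmf.prob (pmf_of_set (uncrossed_walls (\<lambda>j. cell (h j)) t)) {H. adjacent_across H (cell (h t)) (cell (bump (h t) a))}"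
      by (rule mp[rotated])
    then show ?thesis unfolding step_probability[OF n2 h a] .
  qed
  then have "prob {\<omega> \<in> space M. X (Suc t) \<omega> = cell (bump (h t) a) \<and> (\<forall>j\<le>t. X j \<omega> = cell (h j))}
      = prob (path_event M X t h) / real (card (open_moves (h t)))"
    using True by (simp add: cond_prob_def path_event_def divide_eq_eq)
  moreover have "{\<omega> \<in> space M. X (Suc t) \<omega> = cell (bump (h t) a) \<and> (\<forall>j\<le>t. X j \<omega> = cell (h j))}
      = path_event M X (Suc t) (h(Suc t := bump (h t) a))"
    unfolding path_event_Suc by (auto simp: path_event_def)
  ultimately show ?thesis by simp
next
  case False
  \<comment> \<open>For a history of probability zero the definition of the walk prescribes nothing,
    but then both sides vanish.\<close>
  then have zero: "prob (path_event M X t h) = 0" using measure_nonneg[of M "path_event M X t h"] by linarith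
  have "path_event M X (Suc t) (h(Suc t := bump (h t) a)) \<subseteq> path_event M X t h" unfolding path_event_Suc by auto
  then have "prob (path_event M X (Suc t) (h(Suc t := bump (h t) a))) \<le> prob (path_event M X t h)"
    using path_event_sets[OF h] by (rule finite_measure_mono)
  then have "prob (path_event M X (Suc t) (h(Suc t := bump (h t) a))) = 0"
    using zero measure_nonneg[of M "path_event M X (Suc t) (h(Suc t := bump (h t) a))"] by linarith
  then show ?thesis using zero by simp
qed

text \<open>The sum runs over inner moves while the divisor counts all open moves: paths that leave
  the chamber are dropped, so the weights form a sub-probability.\<close>

lemma sum_path_event_Suc:
  "(\<Sum>h\<in>histories (Suc t). prob (path_event M X (Suc t) h) * f (h (Suc t)))
    = (\<Sum>h\<in>histories t. prob (path_event M X t h) * ((\<Sum>a\<in>inner_moves (h t). f (bump (h t) a)) / real (card (open_moves (h t)))))"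
proof -
  have "(\<Sum>a\<in>inner_moves (h t). prob (path_event M X (Suc t) (h(Suc t := bump (h t) a))) * f (bump (h t) a))
      = prob (path_event M X t h) * ((\<Sum>a\<in>inner_moves (h t). f (bump (h t) a)) / real (card (open_moves (h t))))"
    if h: "h \<in> histories t" for h
  proof -
    have "(\<Sum>a\<in>inner_moves (h t). prob (path_event M X (Suc t) (h(Suc t := bump (h t) a))) * f (bump (h t) a))
        = (\<Sum>a\<in>inner_moves (h t). prob (path_event M X t h) / real (card (open_moves (h t))) * f (bump (h t) a))"
      using inner_moves_subset_open_moves[of "h t"] prob_path_event_Suc[OF h] by (intro sum.cong) auto
    then show ?thesis by (simp add: sum_distrib_left sum_divide_distrib)
  qed
  then show ?thesis unfolding sum_histories_Suc[OF n2] by simp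
qed

lemma card_moves:
  assumes "alcove_code (p :: 'n \<Rightarrow> int)"
  shows "card (inner_moves p) \<le> card (open_moves p)" "card (open_moves p) > 0"
proof -
  show "card (inner_moves p) \<le> card (open_moves p)"
    using inner_moves_subset_open_moves by (intro card_mono) auto
  moreover have "card (inner_moves p) > 0"
    using inner_moves_nonempty[OF assms n2] by (simp add: card_gt_0_iff)
  ultimately show "card (open_moves p) > 0" by linarith
qed

lemma total_path_probability: "(\<Sum>h\<in>histories t. prob (path_event M X t h)) \<le> 1"
proof (induction t)
  case (Suc t)
  have "(\<Sum>h\<in>histories (Suc t). prob (path_event M X (Suc t) h))
      = (\<Sum>h\<in>histories t. prob (path_event M X t h) * (real (card (inner_moves (h t))) / real (card (open_moves (h t)))))"
    using sum_path_event_Suc[of t "\<lambda>_. 1"] by simp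
  also have "\<dots> \<le> (\<Sum>h\<in>histories t. prob (path_event M X t h) * 1)"
    using card_moves[OF history_code] by (intro sum_mono mult_left_mono) (auto simp: divide_le_eq_1)
  finally show ?case using Suc by simp
qed simp

text \<open>In the expansion of the square the cross term is \<open>2 * D p\<close> times the
  balanced sum, so it vanishes whatever the number of open moves, and one step adds at most
  \<open>K^2\<close>. Mass lost by leaving the chamber only lowers the left-hand side.\<close>

lemma second_moment_bound:
  assumes balanced: "\<And>p. alcove_code p \<Longrightarrow> (\<Sum>a\<in>inner_moves p. D (bump p a) - D p) = 0"
    and jump: "\<And>p a. alcove_code p \<Longrightarrow> a \<in> inner_moves p \<Longrightarrow> \<bar>D (bump p a) - D p\<bar> \<le> K"
  shows "(\<Sum>h\<in>histories t. prob (path_event M X t h) * (D (h t))\<^sup>2) \<le> (D origin_code)\<^sup>2 + K\<^sup>2 * real t"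
proof (induction t)
  case 0
  show ?case using mult_right_mono[OF prob_le_1, of "(D origin_code)\<^sup>2"] by simp
next
  case (Suc t)
  have step: "(\<Sum>a\<in>inner_moves p. (D (bump p a))\<^sup>2) / real (card (open_moves p)) \<le> (D p)\<^sup>2 + K\<^sup>2"
    if p: "alcove_code p" for p :: "'n \<Rightarrow> int"
  proof -
    have "(D (bump p a))\<^sup>2 \<le> (D p)\<^sup>2 + 2 * D p * (D (bump p a) - D p) + K\<^sup>2" if "a \<in> inner_moves p" for a
    proof -
      have "(D (bump p a) - D p)\<^sup>2 \<le> K\<^sup>2" using jump[OF p that] by (metis abs_ge_zero power2_abs power_mono)
      then show ?thesis by (simp add: power2_eq_square algebra_simps)
    qed
    then have "(\<Sum>a\<in>inner_moves p. (D (bump p a))\<^sup>2)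
        \<le> (\<Sum>a\<in>inner_moves p. (D p)\<^sup>2 + 2 * D p * (D (bump p a) - D p) + K\<^sup>2)" by (rule sum_mono)
    also have "\<dots> = real (card (inner_moves p)) * ((D p)\<^sup>2 + K\<^sup>2) + 2 * D p * (\<Sum>a\<in>inner_moves p. D (bump p a) - D p)"
      unfolding sum.distrib sum_distrib_left[symmetric] by (simp add: algebra_simps)
    also have "\<dots> \<le> real (card (open_moves p)) * ((D p)\<^sup>2 + K\<^sup>2)"
      unfolding balanced[OF p] using card_moves[OF p] by (simp add: mult_right_mono)
    finally show ?thesis using card_moves[OF p] by (simp add: divide_le_eq mult.commute)
  qed
  have "(\<Sum>h\<in>histories (Suc t). prob (path_event M X (Suc t) h) * (D (h (Suc t)))\<^sup>2)
      = (\<Sum>h\<in>histories t. prob (path_event M X t h) * ((\<Sum>a\<in>inner_moves (h t). (D (bump (h t) a))\<^sup>2) / real (card (open_moves (h t)))))"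
    by (rule sum_path_event_Suc)
  also have "\<dots> \<le> (\<Sum>h\<in>histories t. prob (path_event M X t h) * ((D (h t))\<^sup>2 + K\<^sup>2))"
    using step history_code by (intro sum_mono mult_left_mono) auto
  also have "\<dots> = (\<Sum>h\<in>histories t. prob (path_event M X t h) * (D (h t))\<^sup>2) + (\<Sum>h\<in>histories t. prob (path_event M X t h)) * K\<^sup>2"
    by (simp add: distrib_left sum.distrib sum_distrib_right)
  also have "\<dots> \<le> ((D origin_code)\<^sup>2 + K\<^sup>2 * real t) + 1 * K\<^sup>2"
    using Suc total_path_probability[of t] by (intro add_mono mult_right_mono) auto
  finally show ?case by (simp add: algebra_simps)
qed

text \<open>The extensions by open moves are disjoint, and their equal shares already add up to the
  probability of the history.\<close>

lemma AE_open_move: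
  assumes h: "h \<in> histories t"
  shows "AE \<omega> in M. \<omega> \<in> path_event M X t h \<longrightarrow> (\<exists>a\<in>open_moves (h t). \<omega> \<in> path_event M X (Suc t) (h(Suc t := bump (h t) a)))"
proof -
  let ?p = "h t"
  let ?E = "\<lambda>a. path_event M X (Suc t) (h(Suc t := bump ?p a))"
  have code: "alcove_code ?p" using history_code[OF h] .
  have sets: "?E a \<in> sets M" for a
  proof -
    have "?E a = path_event M X t h \<inter> (X (Suc t) -` {cell (bump ?p a)} \<inter> space M)"
      unfolding path_event_Suc by (auto simp: path_event_def)
    moreover have "X (Suc t) \<in> measurable M (count_space alcoves)" using walk by (simp add: reduced_random_walk_def)
    moreover have "cell (bump ?p a) \<in> alcoves" using alcove_code_bump[OF code n2] by (auto simp: alcoves_eq)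
    ultimately show ?thesis
      using path_event_sets[OF h] by (auto intro!: sets.Int measurable_sets[of _ M "count_space alcoves"])
  qed
  have disj: "disjoint_family_on ?E (open_moves ?p)"
  proof -
    have "a = c" if "cell (bump ?p a) = cell (bump ?p c)" for a c
      using bump_inject[OF code n2] cell_inject[OF alcove_code_bump[OF code n2] alcove_code_bump[OF code n2] that] .
    then show ?thesis unfolding disjoint_family_on_def path_event_Suc by auto
  qed
  let ?N = "path_event M X t h - (\<Union>a\<in>open_moves ?p. ?E a)"
  have "prob (\<Union>a\<in>open_moves ?p. ?E a) = (\<Sum>a\<in>open_moves ?p. prob (?E a))"
    using sets disj by (intro finite_measure_finite_Union) auto
  also have "\<dots> = prob (path_event M X t h)"
    using prob_path_event_Suc[OF h] card_moves(2)[OF code] by (simp add: card_gt_0_iff)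
  finally have "prob ?N = 0"
    using sets path_event_sets[OF h] by (subst finite_measure_Diff) (auto simp: path_event_Suc)
  then have "emeasure M ?N = 0" by (simp add: emeasure_eq_measure)
  then show ?thesis
    using sets path_event_sets[OF h] by (intro AE_I[where N="?N"]) auto
qed

lemma AE_history:
  "AE \<omega> in M. (\<forall>j. X j \<omega> \<subseteq> fundamental_chamber) \<longrightarrow> (\<forall>t. \<exists>h\<in>histories t. \<omega> \<in> path_event M X t h)"
proof -
  have "AE \<omega> in M. (\<forall>j. X j \<omega> \<subseteq> fundamental_chamber) \<longrightarrow> (\<exists>h\<in>histories t. \<omega> \<in> path_event M X t h)" for t
  proof (induction t)
    case 0
    have "AE \<omega> in M. X 0 \<omega> = fundamental_alcove" using walk by (simp add: reduced_random_walk_def)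
    then show ?case using AE_space
      by eventually_elim (simp add: path_event_def cell_origin_code)
  next
    case (Suc t)
    have "AE \<omega> in M. \<forall>h\<in>histories t. \<omega> \<in> path_event M X t h \<longrightarrow>
        (\<exists>a\<in>open_moves (h t). \<omega> \<in> path_event M X (Suc t) (h(Suc t := bump (h t) a)))"
      unfolding AE_finite_all[OF finite_histories] using AE_open_move by blast
    then show ?case using Suc
    proof eventually_elim
      case (elim \<omega>)
      show ?case
      proof
        assume ch: "\<forall>j. X j \<omega> \<subseteq> fundamental_chamber"
        then obtain h a where h: "h \<in> histories t" and a: "a \<in> open_moves (h t)"
          and \<omega>: "\<omega> \<in> path_event M X (Suc t) (h(Suc t := bump (h t) a))" using elim by blast
        have "cell (bump (h t) a) \<subseteq> fundamental_chamber" using \<omega> ch unfolding path_event_Suc by auto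
        then have "a \<in> inner_moves (h t)" using bump_leaves_chamber[OF history_code[OF h] n2] a by blast
        then show "\<exists>h\<in>histories (Suc t). \<omega> \<in> path_event M X (Suc t) h" using h \<omega> by auto
      qed
    qed
  qed
  then have "AE \<omega> in M. \<forall>t. (\<forall>j. X j \<omega> \<subseteq> fundamental_chamber) \<longrightarrow> (\<exists>h\<in>histories t. \<omega> \<in> path_event M X t h)"
    unfolding AE_all_countable by blast
  then show ?thesis by eventually_elim blast
qed

text \<open>Measurability of the event need not be checked, since \<open>measure\<close> is 0 on
  non-measurable sets.\<close>

lemma AE_not_imp_prob_0:
  assumes "AE \<omega> in M. \<not> P \<omega>"
  shows "prob {\<omega> \<in> space M. P \<omega>} = 0"
proof (cases "{\<omega> \<in> space M. P \<omega>} \<in> sets M")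
  case True
  have "AE \<omega> in M. \<omega> \<notin> {\<omega> \<in> space M. P \<omega>}" using assms by eventually_elim simp
  then have "{\<omega> \<in> space M. P \<omega>} \<in> null_sets M" using True by (simp add: AE_iff_null_sets)
  then show ?thesis by (simp add: null_sets_def measure_def)
qed (simp add: measure_notin_sets)

text \<open>A function of the alcove whose increments are balanced over the moves inside the chamber is,
  on the event of staying in the chamber, \<open>O(\<surd>t)\<close> in mean square, whereas the centres of the
  alcoves grow linearly.\<close>
lemma balanced_functional_vanishes:
  fixes L :: "real ^ 'n::{finite,linorder} \<Rightarrow> real"
  assumes balanced: "\<And>p. alcove_code p \<Longrightarrow> (\<Sum>a\<in>inner_moves p. D (bump p a) - D p) = 0"
    and jump: "\<And>p a. alcove_code p \<Longrightarrow> a \<in> inner_moves p \<Longrightarrow> \<bar>D (bump p a) - D p\<bar> \<le> K"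
    and L: "linear L"
    and close: "\<And>p y. alcove_code p \<Longrightarrow> y \<in> closed_cell p \<Longrightarrow> \<bar>D p - L y\<bar> \<le> C"
    and lim: "\<P>(\<omega> in M. (\<lambda>i. direction (X i \<omega>)) \<longlonglongrightarrow> \<psi> \<bar> \<forall>i. X i \<omega> \<subseteq> fundamental_chamber) = 1"
  shows "L \<psi> = 0"
proof (rule ccontr)
  assume "L \<psi> \<noteq> 0"
  \<comment> \<open>\<open>norm_lower_bound\<close> reads \<open>\<kappa> * t \<le> norm c\<close>.
    Once \<open>L\<close> of the direction exceeds half of its limit in absolute value,
    \<open>L c\<close> is at least \<open>2 * \<epsilon> * t\<close> in absolute value; one of the
    two \<open>\<epsilon> * t\<close> absorbs the error \<open>C\<close>.\<close>
  define \<kappa> where "\<kappa> = 1 / (2 * (real CARD('n))\<^sup>2)"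
  define \<epsilon> where "\<epsilon> = \<kappa> * \<bar>L \<psi>\<bar> / 4"
  have \<kappa>: "\<kappa> > 0" using n2 by (simp add: \<kappa>_def)
  have \<epsilon>: "\<epsilon> > 0" using \<kappa> \<open>L \<psi> \<noteq> 0\<close> by (simp add: \<epsilon>_def)
  define Bad where "Bad t = (\<Union>h\<in>{h\<in>histories t. \<epsilon> * real t \<le> \<bar>D (h t)\<bar>}. path_event M X t h)" for t
  have Bad_sets: "Bad t \<in> sets M" for t
    unfolding Bad_def using path_event_sets finite_histories[of t] by (intro sets.finite_UN) auto
  define B where "B = ((D origin_code)\<^sup>2 + K\<^sup>2) / \<epsilon>\<^sup>2"
  have Bad_prob: "prob (Bad t) \<le> B / real t" if t: "t \<ge> 1" for t
  proof -
    let ?H = "{h\<in>histories t. \<epsilon> * real t \<le> \<bar>D (h t)\<bar>}"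
    have pos: "(\<epsilon> * real t)\<^sup>2 > 0" using \<epsilon> t by simp
    have "prob (Bad t) \<le> (\<Sum>h\<in>?H. prob (path_event M X t h))"
      unfolding Bad_def using path_event_sets finite_histories[of t] by (intro finite_measure_subadditive_finite) auto
    also have "\<dots> * (\<epsilon> * real t)\<^sup>2 = (\<Sum>h\<in>?H. prob (path_event M X t h) * (\<epsilon> * real t)\<^sup>2)"
      by (simp add: sum_distrib_right)
    also have "\<dots> \<le> (\<Sum>h\<in>?H. prob (path_event M X t h) * (D (h t))\<^sup>2)"
    proof (intro sum_mono mult_left_mono)
      fix h assume "h \<in> ?H"
      then have "\<epsilon> * real t \<le> \<bar>D (h t)\<bar>" by simp
      then show "(\<epsilon> * real t)\<^sup>2 \<le> (D (h t))\<^sup>2" using \<epsilon> by (metis abs_of_nonneg less_imp_le mult_nonneg_nonneg of_nat_0_le_iff power2_abs power_mono)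
    qed simp
    also have "\<dots> \<le> (\<Sum>h\<in>histories t. prob (path_event M X t h) * (D (h t))\<^sup>2)"
      using finite_histories by (intro sum_mono2) auto
    also have "\<dots> \<le> (D origin_code)\<^sup>2 + K\<^sup>2 * real t" by (rule second_moment_bound[OF balanced jump])
    also have "\<dots> \<le> ((D origin_code)\<^sup>2 + K\<^sup>2) * real t"
      using t mult_left_mono[of 1 "real t" "(D origin_code)\<^sup>2"] by (simp add: algebra_simps)
    finally have "prob (Bad t) * (\<epsilon> * real t)\<^sup>2 \<le> ((D origin_code)\<^sup>2 + K\<^sup>2) * real t"
      by (simp add: mult_right_mono)
    then have "prob (Bad t) \<le> ((D origin_code)\<^sup>2 + K\<^sup>2) * real t / (\<epsilon> * real t)\<^sup>2"
      using pos by (simp add: le_divide_eq)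
    also have "\<dots> = B / real t" using t \<epsilon> by (simp add: B_def power2_eq_square field_simps)
    finally show ?thesis .
  qed
  \<comment> \<open>The Chebyshev bound \<open>B / t\<close> is not summable, but being bad at all
    times from \<open>T\<close> on is no likelier than being bad at any single late time.\<close>
  have null: "(\<Inter>t\<in>{T..}. Bad t) \<in> null_sets M" for T
  proof -
    let ?F = "\<Inter>t\<in>{T..}. Bad t"
    have sets: "?F \<in> sets M" using Bad_sets by (intro sets.countable_INT) auto
    have le: "prob ?F \<le> B / real t" if "t \<ge> max 1 T" for t
    proof -
      have "prob ?F \<le> prob (Bad t)" using that Bad_sets by (intro finite_measure_mono) auto
      then show ?thesis using Bad_prob[of t] that by simp
    qed
    have "prob ?F \<le> 0"
      using lim_const_over_n[of B]
      by (rule LIMSEQ_le_const) (use le in blast)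
    then show ?thesis using sets by (intro null_setsI) (simp_all add: emeasure_eq_measure measure_le_0_iff)
  qed
  have "AE \<omega> in M. \<forall>T. \<omega> \<notin> (\<Inter>t\<in>{T..}. Bad t)"
    unfolding AE_all_countable using null AE_not_in by blast
  then have "AE \<omega> in M. \<not> ((\<lambda>i. direction (X i \<omega>)) \<longlonglongrightarrow> \<psi> \<and> (\<forall>i. X i \<omega> \<subseteq> fundamental_chamber))"
    using AE_history
  proof eventually_elim
    case (elim \<omega>)
    show ?case
    proof
      assume A: "(\<lambda>i. direction (X i \<omega>)) \<longlonglongrightarrow> \<psi> \<and> (\<forall>i. X i \<omega> \<subseteq> fundamental_chamber)"
      have "(\<lambda>i. \<bar>L (direction (X i \<omega>))\<bar>) \<longlonglongrightarrow> \<bar>L \<psi>\<bar>"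
        using A L by (intro tendsto_rabs bounded_linear.tendsto[of L]) (auto simp: linear_conv_bounded_linear)
      then have "eventually (\<lambda>i. \<bar>L \<psi>\<bar> / 2 < \<bar>L (direction (X i \<omega>))\<bar>) sequentially"
        using \<open>L \<psi> \<noteq> 0\<close> by (intro order_tendstoD(1)) auto
      moreover have "eventually (\<lambda>i. C / \<epsilon> \<le> real i) sequentially"
        using filterlim_real_sequentially by (simp add: filterlim_at_top)
      ultimately have "eventually (\<lambda>i. \<omega> \<in> Bad i) sequentially"
      proof eventually_elim
        case (elim t)
        obtain h where h: "h \<in> histories t" "\<omega> \<in> path_event M X t h"
          using \<open>(\<forall>j. X j \<omega> \<subseteq> fundamental_chamber) \<longrightarrow> _\<close> A by blast
        define c where "c = central_point (cell (h t))"
        have code: "alcove_code (h t)" by (rule history_code[OF h(1)])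
        have c: "c \<in> closed_cell (h t)" unfolding c_def by (rule central_point_in_closed_cell[OF code n2])
        have Xt: "direction (X t \<omega>) = sgn c" using h(2) by (simp add: path_event_def direction_def c_def)
        have "real t \<le> 2 * (real CARD('n))\<^sup>2 * norm c" by (rule norm_lower_bound[OF n2 h(1) c])
        then have nc: "\<kappa> * real t \<le> norm c" using n2 by (simp add: \<kappa>_def divide_le_eq mult.commute)
        have "c = norm c *\<^sub>R sgn c" by (cases "c = 0") (simp_all add: sgn_div_norm)
        then have "L c = norm c * L (sgn c)" by (metis L linear_scale real_scaleR_def)
        then have "\<bar>L c\<bar> = norm c * \<bar>L (sgn c)\<bar>" by (simp add: abs_mult)
        moreover have "(\<kappa> * real t) * (\<bar>L \<psi>\<bar> / 2) \<le> norm c * \<bar>L (sgn c)\<bar>"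
          using nc elim(1) \<kappa> unfolding Xt by (intro mult_mono) auto
        ultimately have "2 * \<epsilon> * real t \<le> \<bar>L c\<bar>" by (simp add: \<epsilon>_def mult_ac)
        moreover have "\<bar>D (h t) - L c\<bar> \<le> C" by (rule close[OF code c])
        moreover have "C \<le> \<epsilon> * real t" using elim(2) \<epsilon> by (simp add: divide_le_eq mult.commute)
        ultimately have "\<epsilon> * real t \<le> \<bar>D (h t)\<bar>" by linarith
        then show ?case using h unfolding Bad_def by blast
      qed
      then obtain T where "\<forall>t\<ge>T. \<omega> \<in> Bad t" by (auto simp: eventually_sequentially)
      then show False using elim(1) by auto
    qed
  qed
  then have "prob {\<omega> \<in> space M. (\<lambda>i. direction (X i \<omega>)) \<longlonglongrightarrow> \<psi> \<and> (\<forall>i. X i \<omega> \<subseteq> fundamental_chamber)} = 0"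
    by (rule AE_not_imp_prob_0)
  \<comment> \<open>A conditional probability is a quotient; with numerator 0 it is 0 and not 1,
    whatever the probability of staying in the chamber.\<close>
  then show False using lim by (simp add: cond_prob_def)
qed

text \<open>A conditional probability of 1 provides at least one convergent path through histories,
  and closed conditions pass to its limit. The coordinate at \<open>Min UNIV\<close> is nonnegative
  as the largest of numbers with sum zero; this later decides the sign.\<close>

lemma limit_in_closed_chamber:
  assumes lim: "\<P>(\<omega> in M. (\<lambda>i. direction (X i \<omega>)) \<longlonglongrightarrow> \<psi> \<bar> \<forall>i. X i \<omega> \<subseteq> fundamental_chamber) = 1"
  shows "\<psi> \<in> sum_zero_space" "0 \<le> \<psi> $ Min UNIV"
proof -
  have "\<exists>\<omega>. (\<lambda>i. direction (X i \<omega>)) \<longlonglongrightarrow> \<psi> \<and> (\<forall>t. \<exists>h\<in>histories t. \<omega> \<in> path_event M X t h)"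
  proof (rule ccontr)
    assume none: "\<not> ?thesis"
    have "AE \<omega> in M. \<not> ((\<lambda>i. direction (X i \<omega>)) \<longlonglongrightarrow> \<psi> \<and> (\<forall>i. X i \<omega> \<subseteq> fundamental_chamber))"
      using AE_history by eventually_elim (use none in blast)
    then have "prob {\<omega> \<in> space M. (\<lambda>i. direction (X i \<omega>)) \<longlonglongrightarrow> \<psi> \<and> (\<forall>i. X i \<omega> \<subseteq> fundamental_chamber)} = 0"
      by (rule AE_not_imp_prob_0)
    then show False using lim by (simp add: cond_prob_def)
  qed
  then obtain \<omega> where conv: "(\<lambda>i. direction (X i \<omega>)) \<longlonglongrightarrow> \<psi>"
    and hist: "\<And>t. \<exists>h\<in>histories t. \<omega> \<in> path_event M X t h" by blast
  have dir: "direction (X t \<omega>) \<in> sum_zero_space \<and> 0 \<le> direction (X t \<omega>) $ Min UNIV" for t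
  proof -
    obtain h where h: "h \<in> histories t" "\<omega> \<in> path_event M X t h" using hist by blast
    define c where "c = central_point (cell (h t))"
    have c: "c \<in> closed_cell (h t)" unfolding c_def by (rule central_point_in_closed_cell[OF history_code[OF h(1)] n2])
    have Xt: "direction (X t \<omega>) = sgn c" using h(2) by (simp add: path_event_def direction_def c_def)
    have V: "(\<Sum>i\<in>UNIV. c $ i) = 0" using c by (simp add: closed_cell_def sum_zero_space_def)
    have "c $ j \<le> c $ Min UNIV" for j
    proof (cases "j = Min UNIV")
      case False
      moreover have "Min UNIV \<le> j" by simp
      ultimately have "Min UNIV < j" by (metis order.not_eq_order_implies_strict)
      then have "0 \<le> level (h t) (Min UNIV) j" using histories_chamber_code[OF n2 h(1), of t] by (simp add: chamber_code_def)
      moreover have "of_int (level (h t) (Min UNIV) j) \<le> c $ Min UNIV - c $ j" using c False by (auto simp: closed_cell_def)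
      ultimately show ?thesis by linarith
    qed simp
    then have "(\<Sum>j\<in>UNIV. c $ j) \<le> (\<Sum>j\<in>(UNIV::'n set). c $ Min UNIV)" by (rule sum_mono)
    then have "0 \<le> c $ Min UNIV" using V n2 by (simp add: zero_le_mult_iff)
    then show ?thesis using V
      by (simp add: Xt sgn_div_norm sum_zero_space_def flip: sum_distrib_left)
  qed
  show "\<psi> \<in> sum_zero_space" using closed_sequentially[OF closed_sum_zero_space _ conv] dir by blast
  have "(\<lambda>i. direction (X i \<omega>) $ Min UNIV) \<longlonglongrightarrow> \<psi> $ Min UNIV" using conv by (rule tendsto_vec_nth)
  then show "0 \<le> \<psi> $ Min UNIV" by (rule LIMSEQ_le_const) (use dir in blast)
qed

text \<open>Each compensated current divided by its mean has increments of total 1 over the inner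
  moves, at every alcove, so the difference of two of them is balanced.\<close>

lemma partial_sum_ratio:
  fixes k l :: 'n
  assumes lim: "\<P>(\<omega> in M. (\<lambda>i. direction (X i \<omega>)) \<longlonglongrightarrow> \<psi> \<bar> \<forall>i. X i \<omega> \<subseteq> fundamental_chamber) = 1"
    and k: "card {..k} < CARD('n)" and l: "card {..l} < CARD('n)"
  shows "(\<Sum>a\<le>k. \<psi> $ a) / mean_current (CARD('n)) (card {..k}) = (\<Sum>a\<le>l. \<psi> $ a) / mean_current (CARD('n)) (card {..l})"
proof -
  let ?n = "real CARD('n)"
  define ck where "ck = mean_current (CARD('n)) (card {..k})"
  define cl where "cl = mean_current (CARD('n)) (card {..l})"
  have pos: "mean_current (CARD('n)) (card {..m}) > 0" if "card {..m} < CARD('n)" for m :: 'n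
  proof -
    have "card {..m} > 0" by (auto simp: card_gt_0_iff)
    then show ?thesis using that n2 by (auto simp: mean_current_def intro!: divide_pos_pos mult_pos_pos)
  qed
  have c: "ck > 0" "cl > 0" using pos k l by (simp_all add: ck_def cl_def)
  obtain \<Psi>1 :: "('n \<Rightarrow> int) \<Rightarrow> real" and K1 where 1:
    "\<And>p. alcove_code p \<Longrightarrow> (\<Sum>a\<in>inner_moves p. \<Psi>1 (bump p a) - \<Psi>1 p) = ck"
    "\<And>p a. alcove_code p \<Longrightarrow> a \<in> inner_moves p \<Longrightarrow> \<bar>\<Psi>1 (bump p a) - \<Psi>1 p\<bar> \<le> K1"
    "\<And>p. \<bar>\<Psi>1 p - of_int (\<Sum>a\<le>k. p a)\<bar> \<le> K1"
    using compensated_current[OF n2 k] unfolding ck_def by metis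
  obtain \<Psi>2 :: "('n \<Rightarrow> int) \<Rightarrow> real" and K2 where 2:
    "\<And>p. alcove_code p \<Longrightarrow> (\<Sum>a\<in>inner_moves p. \<Psi>2 (bump p a) - \<Psi>2 p) = cl"
    "\<And>p a. alcove_code p \<Longrightarrow> a \<in> inner_moves p \<Longrightarrow> \<bar>\<Psi>2 (bump p a) - \<Psi>2 p\<bar> \<le> K2"
    "\<And>p. \<bar>\<Psi>2 p - of_int (\<Sum>a\<le>l. p a)\<bar> \<le> K2"
    using compensated_current[OF n2 l] unfolding cl_def by metis
  define D where "D p = \<Psi>1 p / ck - \<Psi>2 p / cl" for p
  \<comment> \<open>The factor \<open>n\<close> appears because the place \<open>p a\<close> differs
    from \<open>n * y $ a\<close> by at most \<open>n\<close>.\<close>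
  define L where "L y = ?n * ((\<Sum>a\<le>k. y $ a) / ck - (\<Sum>a\<le>l. y $ a) / cl)" for y :: "(real, 'n) vec"
  have diff: "D p - D q = (\<Psi>1 p - \<Psi>1 q) / ck - (\<Psi>2 p - \<Psi>2 q) / cl" for p q
    by (simp add: D_def diff_divide_distrib)
  have scaled: "\<bar>x / ck - y / cl\<bar> \<le> A / ck + B / cl" if "\<bar>x\<bar> \<le> A" "\<bar>y\<bar> \<le> B" for x y A B
  proof -
    have "\<bar>x / ck\<bar> \<le> A / ck" "\<bar>y / cl\<bar> \<le> B / cl" using that c by (simp_all add: abs_divide divide_right_mono)
    then show ?thesis by linarith
  qed
  have "L \<psi> = 0"
  proof (rule balanced_functional_vanishes[OF _ _ _ _ lim])
    fix p :: "'n \<Rightarrow> int" assume p: "alcove_code p"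
    show "(\<Sum>a\<in>inner_moves p. D (bump p a) - D p) = 0"
      unfolding diff sum_subtractf sum_divide_distrib[symmetric] using 1(1)[OF p] 2(1)[OF p] c
      by (simp add: sum_subtractf)
  next
    fix p :: "'n \<Rightarrow> int" and a assume p: "alcove_code p" and a: "a \<in> inner_moves p"
    show "\<bar>D (bump p a) - D p\<bar> \<le> K1 / ck + K2 / cl"
      unfolding diff by (intro scaled 1(2)[OF p a] 2(2)[OF p a])
  next
    show "linear L"
      by (rule linearI) (simp_all add: L_def sum.distrib add_divide_distrib algebra_simps flip: sum_distrib_left)
  next
    fix p :: "'n \<Rightarrow> int" and y assume p: "alcove_code p" and y: "y \<in> closed_cell p"
    have near: "\<bar>of_int (\<Sum>a\<le>m. p a) - ?n * (\<Sum>a\<le>m. y $ a)\<bar> \<le> ?n * ?n" for m :: 'n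
    proof -
      have "\<bar>of_int (\<Sum>a\<le>m. p a) - ?n * (\<Sum>a\<le>m. y $ a)\<bar> = \<bar>\<Sum>a\<le>m. of_int (p a) - ?n * y $ a\<bar>"
        by (simp add: sum_subtractf sum_distrib_left)
      also have "\<dots> \<le> (\<Sum>a\<le>m. ?n)"
        using closed_cell_place_bounds[OF p y] by (intro sum_abs[THEN order_trans] sum_mono) (smt (verit))
      also have "\<dots> \<le> ?n * ?n"
      proof -
        have "card {..m} \<le> CARD('n)" by (rule card_mono) auto
        then show ?thesis by simp
      qed
      finally show ?thesis .
    qed
    have "D p - L y = (\<Psi>1 p - ?n * (\<Sum>a\<le>k. y $ a)) / ck - (\<Psi>2 p - ?n * (\<Sum>a\<le>l. y $ a)) / cl"
      by (simp add: D_def L_def diff_divide_distrib algebra_simps)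
    also have "\<bar>\<dots>\<bar> \<le> (K1 + ?n * ?n) / ck + (K2 + ?n * ?n) / cl"
      using 1(3)[of p] 2(3)[of p] near[of k] near[of l] by (intro scaled) linarith+
    finally show "\<bar>D p - L y\<bar> \<le> (K1 + ?n * ?n) / ck + (K2 + ?n * ?n) / cl" .
  qed
  then show ?thesis using n2 by (simp add: L_def ck_def cl_def)
qed

end

section \<open>From partial sums to the unit vector\<close>

lemma sum_coord_index:
  fixes f :: "nat \<Rightarrow> real" and k :: "'n::{finite,linorder}"
  shows "(\<Sum>a\<le>k. f (coord_index a)) = (\<Sum>r=1..coord_index k. f r)"
proof -
  have mono: "coord_index a < coord_index c" if "a < c" for a c :: 'n
    unfolding coord_index_def using that by (intro psubset_card_mono) auto
  have inj: "inj_on coord_index {..k}"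
    by (rule linorder_inj_onI) (use mono in \<open>auto simp: less_irrefl dest: mono\<close>)
  have "coord_index ` {..k} = {1..coord_index k}"
  proof (rule card_subset_eq)
    show "coord_index ` {..k} \<subseteq> {1..coord_index k}"
    proof clarify
      fix a assume "a \<le> k"
      then have "card {..a} \<le> card {..k}" by (intro card_mono) auto
      moreover have "card {..a} > 0" by (auto simp: card_gt_0_iff)
      ultimately show "coord_index a \<in> {1..coord_index k}" by (simp add: coord_index_def)
    qed
    show "card (coord_index ` {..k}) = card {1..coord_index k}"
      using inj by (simp add: card_image) (simp add: coord_index_def)
  qed simp
  then show ?thesis using sum.reindex[OF inj, of f] by simp
qed

lemma sum_linear_coefficients: "(\<Sum>r=1..m. x + 1 - 2 * real r) = real m * (x - real m)"
  by (induction m) (simp_all add: algebra_simps)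

text \<open>Leaving \<open>x\<close> free makes the induction on \<open>m\<close> possible. At
  \<open>m = x = n\<close> the right-hand side is \<open>n (n^2 - 1)\<close>, which is 6 times
  \<open>(n + 1) choose 3\<close>.\<close>

lemma sum_square_coefficients: "3 * (\<Sum>r=1..m. (x + 1 - 2 * real r)\<^sup>2) = real m * (3 * (x - real m)\<^sup>2 + (real m)\<^sup>2 - 1)"
  by (induction m) (simp_all add: power2_eq_square algebra_simps)

lemma eq_from_partial_sums:
  fixes u v :: "'n::{finite,linorder} \<Rightarrow> real"
  assumes "\<And>k. (\<Sum>a\<le>k. u a) = (\<Sum>a\<le>k. v a)"
  shows "u k = v k"
proof (induction "card {..<k}" arbitrary: k rule: less_induct)
  case less
  have "u a = v a" if "a \<in> {..<k}" for a
    using that by (intro less psubset_card_mono) auto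
  then have "(\<Sum>a\<in>{..<k}. u a) = (\<Sum>a\<in>{..<k}. v a)" by (rule sum.cong[OF refl])
  moreover have "{..k} = insert k {..<k}" by auto
  ultimately show ?case using assms[of k] by simp
qed

theorem theorem3p1:
  fixes M :: "'w measure"
    and X :: "nat \<Rightarrow> 'w \<Rightarrow> (real ^ 'n::{finite,linorder}) set"
    and \<psi> :: "real ^ 'n::{finite,linorder}"
  assumes "CARD('n) \<ge> 2"
    and "reduced_random_walk M X"
    and "norm \<psi> = 1"
    and "\<P>(\<omega> in M. (\<lambda>i. direction (X i \<omega>)) \<longlonglongrightarrow> \<psi> \<bar> \<forall>i. X i \<omega> \<subseteq> fundamental_chamber) = 1"
  shows "\<psi> = (1 / sqrt (2 * real ((CARD('n) + 1) choose 3))) *\<^sub>R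
               (\<Sum>k\<in>UNIV. (real CARD('n) + 1 - 2 * real (coord_index k)) *\<^sub>R axis k 1)"
proof -
  interpret reduced_walk M X using assms(1,2) by unfold_locales
  let ?n = "CARD('n)" and ?w = "\<lambda>k::'n. real CARD('n) + 1 - 2 * real (coord_index k)"
  define k0 where "k0 = (Min UNIV :: 'n)"
  have "{..k0} = {k0}" by (auto simp: k0_def intro: antisym)
  then have k0: "card {..k0} = 1" "(\<Sum>a\<le>k0. \<psi> $ a) = \<psi> $ k0" by simp_all
  \<comment> \<open>The least label, whose partial sum is a single coordinate, is the reference for
    all ratios; dividing by \<open>n - 1\<close> turns \<open>mean_current\<close> into
    \<open>j (n - j)\<close>.\<close>
  define \<mu> where "\<mu> = \<psi> $ k0 / mean_current ?n 1 / (real ?n - 1)"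
  have \<mu>0: "\<mu> \<ge> 0" using limit_in_closed_chamber(2)[OF assms(4)] assms(1)
    by (auto simp: \<mu>_def mean_current_def k0_def)
  have partial: "(\<Sum>a\<le>k. \<psi> $ a) = \<mu> * (real (coord_index k) * (real ?n - real (coord_index k)))" for k
  proof (cases "card {..k} < ?n")
    case True
    have "card {..k} > 0" by (auto simp: card_gt_0_iff)
    then have c: "mean_current ?n (card {..k}) > 0"
      using True assms(1) by (auto simp: mean_current_def intro!: divide_pos_pos mult_pos_pos)
    have "(\<Sum>a\<le>k. \<psi> $ a) / mean_current ?n (card {..k}) = \<psi> $ k0 / mean_current ?n 1"
      using partial_sum_ratio[OF assms(4) True, of k0] k0 assms(1) by simp
    then have "(\<Sum>a\<le>k. \<psi> $ a) = \<psi> $ k0 / mean_current ?n 1 * mean_current ?n (card {..k})"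
      using c by (simp add: divide_eq_eq)
    then show ?thesis by (simp add: \<mu>_def mean_current_def coord_index_def)
  next
    case False
    \<comment> \<open>For the last label \<open>mean_current\<close> is 0 and the ratio is void;
      here both sides vanish because the coordinates sum to zero.\<close>
    have "card {..k} \<le> ?n" by (rule card_mono) auto
    then have n: "card {..k} = ?n" using False by simp
    then have "{..k} = UNIV" by (metis card_subset_eq finite subset_UNIV)
    then have "(\<Sum>a\<le>k. \<psi> $ a) = 0"
      using limit_in_closed_chamber(1)[OF assms(4)] by (simp add: sum_zero_space_def)
    then show ?thesis using n by (simp add: coord_index_def)
  qed
  have \<psi>: "\<psi> $ k = \<mu> * ?w k" for k
  proof (rule eq_from_partial_sums)
    fix k
    have "(\<Sum>a\<le>k. \<mu> * ?w a) = \<mu> * (\<Sum>a\<le>k. ?w a)" by (simp add: sum_distrib_left)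
    also have "(\<Sum>a\<le>k. ?w a) = real (coord_index k) * (real ?n - real (coord_index k))"
      using sum_coord_index[of "\<lambda>r. real ?n + 1 - 2 * real r" k] sum_linear_coefficients by simp
    finally show "(\<Sum>a\<le>k. \<psi> $ a) = (\<Sum>a\<le>k. \<mu> * ?w a)" using partial by simp
  qed
  have "{..Max UNIV} = (UNIV :: 'n set)" by auto
  then have "(\<Sum>k\<in>UNIV. (?w k)\<^sup>2) = (\<Sum>r=1..?n. (real ?n + 1 - 2 * real r)\<^sup>2)"
    using sum_coord_index[of "\<lambda>r. (real ?n + 1 - 2 * real r)\<^sup>2" "Max UNIV :: 'n"]
    unfolding coord_index_def[of "Max UNIV"] by (simp only:)
  also have "\<dots> = 2 * real ((?n + 1) choose 3)"
  proof -
    obtain m where m: "?n = Suc (Suc m)" using le_Suc_ex[OF assms(1)] by auto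
    have "real ((?n + 1) choose 3) = real (m + 3) * real (m + 2) * real (m + 1) / 6"
      unfolding m by (simp add: binomial_gbinomial gbinomial_prod_rev numeral_3_eq_3 fact_numeral field_simps)
    moreover have "3 * (\<Sum>r=1..?n. (real ?n + 1 - 2 * real r)\<^sup>2) = real (m + 3) * real (m + 2) * real (m + 1)"
      unfolding sum_square_coefficients unfolding m by (simp add: power2_eq_square algebra_simps)
    ultimately show ?thesis by simp
  qed
  finally have sq: "(\<Sum>k\<in>UNIV. (?w k)\<^sup>2) = 2 * real ((?n + 1) choose 3)" .
  \<comment> \<open>The unit norm determines \<open>\<mu>\<close> up to sign, and
    \<open>\<mu> \<ge> 0\<close> selects the positive root.\<close>
  have "1 = sqrt (\<Sum>k\<in>UNIV. (\<mu> * ?w k)\<^sup>2)"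
    using assms(3) by (simp add: norm_vec_def L2_set_def \<psi>)
  also have "\<dots> = \<mu> * sqrt (2 * real ((?n + 1) choose 3))"
    using \<mu>0 by (simp add: power_mult_distrib real_sqrt_mult sq flip: sum_distrib_left)
  finally have "\<mu> = 1 / sqrt (2 * real ((?n + 1) choose 3))"
    by (metis eq_divide_eq mult_eq_0_iff zero_neq_one)
  then show ?thesis
    by (simp add: vec_eq_iff \<psi> axis_def if_distrib cong: if_cong)
qed

end
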